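(* There exists an online edge-coloring algorithm which, on $n$-vertex simple graphs of known maximum degree $\Delta=\omega(\log n)$ whose edges arrive online, outputs with high probability in $n$ a proper edge coloring using $\Delta+q'$ colors, where $$q' = O\!\left(\Delta^{3/4}\log^{1/2}\Delta + \Delta^{2/3}\log^{1/3} n\right).$$ In particular it uses $(1+o(1))\Delta$ colors.
   Context: Online edge coloring under adversarial edge arrivals: the edges of the graph arrive one at a time in an order fixed in advance by an oblivious adversary; upon arrival, each edge must be irrevocably assigned a color different from the colors of all previously arrived edges sharing an endpoint with it. The maximum degree $\Delta$ is known to the algorithm in advance. "With high probability in $n$" means with probability at least $1-n^{-c}$ for some constant $c>0$. *)

theory Defs
  imports "HOL-Probability.Probability" "HOL-Library.Landau_Symbols"
begin

type_synonym edge = "nat set"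

definition max_degree :: "nat \<Rightarrow> edge set \<Rightarrow> nat" where
  "max_degree n E = Max ((\<lambda>v. card {e \<in> E. v \<in> e}) ` {..<n})"

text \<open>
  An arrival sequence of the edges of a simple graph with vertex set \<open>{..<n}\<close>
  (possibly with isolated vertices) and maximum degree exactly \<open>d\<close>.
\<close>

definition edge_arrivals :: "nat \<Rightarrow> nat \<Rightarrow> edge list \<Rightarrow> bool" where
  "edge_arrivals n d es \<longleftrightarrow>
     distinct es \<and> (\<forall>e\<in>set es. e \<subseteq> {..<n} \<and> card e = 2) \<and> max_degree n (set es) = d"

definition proper_edge_coloring :: "edge set \<Rightarrow> nat set \<Rightarrow> (edge \<Rightarrow> nat) \<Rightarrow> bool" where
  "proper_edge_coloring E C \<phi> \<longleftrightarrow>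
     (\<forall>e\<in>E. \<phi> e \<in> C) \<and> (\<forall>e\<in>E. \<forall>f\<in>E. e \<noteq> f \<and> e \<inter> f \<noteq> {} \<longrightarrow> \<phi> e \<noteq> \<phi> f)"

text \<open>
  A history lists the edges that have arrived, in order of arrival, with their colors. A randomized
  online algorithm maps the history and the arriving edge to the distribution of the color of
  that edge. Colors are natural numbers, so there is no a priori bound on their number. No separate
  random memory is needed: any internal state can be resampled from its conditional distribution
  given the history.
\<close>

type_synonym history = "(edge \<times> nat) list"
type_synonym online_alg = "history \<Rightarrow> edge \<Rightarrow> nat pmf"

text \<open>
  The arriving edge never gets a color of an earlier edge sharing an endpoint with it.
\<close>

definition online_edge_coloring_alg :: "online_alg \<Rightarrow> bool" where
  "online_edge_coloring_alg A \<longleftrightarrow>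
     (\<forall>h e. \<forall>c\<in>set_pmf (A h e). \<forall>(f, d)\<in>set h. e \<inter> f \<noteq> {} \<longrightarrow> c \<noteq> d)"

text \<open>
  The sequence of edges is an argument fixed before any random choice is made: the adversary is
  oblivious.
\<close>

primrec run_from :: "online_alg \<Rightarrow> history \<Rightarrow> edge list \<Rightarrow> history pmf" where
  "run_from A h [] = return_pmf h"
| "run_from A h (e # es) = bind_pmf (A h e) (\<lambda>c. run_from A (h @ [(e, c)]) es)"

definition output_coloring :: "online_alg \<Rightarrow> edge list \<Rightarrow> (edge \<Rightarrow> nat) pmf" where
  "output_coloring A es = map_pmf (\<lambda>h e. the (map_of h e)) (run_from A [] es)"

end

theory Submission
  imports Defs "HOL-Real_Asymp.Real_Asymp"
begin

text \<open>
  The colors are handled one after the other: color \<open>i\<close> extracts a matching from the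
  edges that were refused by all smaller colors. If every degree in that remaining graph is at most
  \<open>d\<close>, the matching takes each edge with probability at least
  \<open>(1 - O(d powr (-1/4))) / d\<close>.

  The matching keeps weights \<open>Y\<close> on the vertices, initially 1. An edge
  \<open>{a, b}\<close> is taken with probability \<open>p = x * Y a * Y b\<close>; then
  \<open>Y a\<close> and \<open>Y b\<close> become 0, otherwise they are divided by
  \<open>1 - p\<close>. So every \<open>Y a\<close> is a martingale, and so is
  \<open>Y u * Y v\<close> until \<open>{u, v}\<close> arrives: the edge is taken with
  probability exactly \<open>x\<close>, up to the effect of capping the weights at
  \<open>B\<close>. To bound this effect, use \<open>Y u * Y v\<close> as a change of measure.
  Under the new measure the edges at \<open>u\<close> are never taken, and a refused edge
  \<open>{u, w}\<close> decreases \<open>1 / Y u\<close> by exactly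
  \<open>x * Y w\<close>, so \<open>1 / Y u\<close> is \<open>1 - x * deg u\<close> in the
  mean; a second moment estimate gives the concentration.

  Over the colors, the ratios \<open>deg v / d\<close>, where \<open>d\<close> shrinks by
  slightly less than 1 per color, are controlled by an exponential supermartingale, stopped as soon
  as some degree exceeds \<open>d\<close>. When \<open>d\<close> has dropped to
  \<open>\<Delta> powr (2/3) * (4 * ln n) powr (1/3)\<close>, the remaining edges are colored greedily.
\<close>

section \<open>One color\<close>

text \<open>The comparison with \<open>B * (1 - p)\<close> asks whether the weight after a refusal,
  \<open>Y v / (1 - p)\<close>, would still be at most \<open>B\<close>. An edge that fails this
  test gets probability 0 and so leaves all weights unchanged.\<close>

definition match_prob :: "real \<Rightarrow> real \<Rightarrow> (nat \<Rightarrow> real) \<Rightarrow> edge \<Rightarrow> real" where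
  "match_prob x B Y e =
     (let p = x * (\<Prod>v\<in>e. Y v) in if \<forall>v\<in>e. 0 < Y v \<and> Y v \<le> B * (1 - p) then p else 0)"

definition hit :: "(nat \<Rightarrow> real) \<Rightarrow> edge \<Rightarrow> nat \<Rightarrow> real" where
  "hit Y e = (\<lambda>w. if w \<in> e then 0 else Y w)"

definition miss :: "real \<Rightarrow> real \<Rightarrow> (nat \<Rightarrow> real) \<Rightarrow> edge \<Rightarrow> nat \<Rightarrow> real" where
  "miss x B Y e = (\<lambda>w. if w \<in> e then Y w / (1 - match_prob x B Y e) else Y w)"

text \<open>
  The expectation of a function of the weights after the edges \<open>es\<close>, as long as
  \<open>match_prob\<close> stays in \<open>[0, 1]\<close>.
\<close>

primrec expect :: "real \<Rightarrow> real \<Rightarrow> (nat \<Rightarrow> real) \<Rightarrow> edge list \<Rightarrow> ((nat \<Rightarrow> real) \<Rightarrow> real) \<Rightarrow> real" where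
  "expect x B Y [] f = f Y"
| "expect x B Y (e # es) f =
     match_prob x B Y e * expect x B (hit Y e) es f
     + (1 - match_prob x B Y e) * expect x B (miss x B Y e) es f"

primrec unmatched :: "real \<Rightarrow> real \<Rightarrow> (nat \<Rightarrow> real) \<Rightarrow> edge list \<Rightarrow> edge list pmf" where
  "unmatched x B Y [] = return_pmf []"
| "unmatched x B Y (e # es) = bind_pmf (bernoulli_pmf (match_prob x B Y e))
     (\<lambda>b. if b then unmatched x B (hit Y e) es
          else map_pmf ((#) e) (unmatched x B (miss x B Y e) es))"

lemma finite_unmatched: "finite (set_pmf (unmatched x B Y es))"
  by (induction es arbitrary: Y) auto

lemma unmatched_ConsE:
  assumes "r \<in> set_pmf (unmatched x B Y (e # es))"
  obtains "r \<in> set_pmf (unmatched x B (hit Y e) es)"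
    | r' where "r = e # r'" "r' \<in> set_pmf (unmatched x B (miss x B Y e) es)"
  using assms by (auto split: if_splits)

lemma unmatched_subset: "r \<in> set_pmf (unmatched x B Y es) \<Longrightarrow> set r \<subseteq> set es"
  by (induction es arbitrary: Y r) (auto split: if_splits, blast+)

lemma unmatched_distinct:
  "\<lbrakk>r \<in> set_pmf (unmatched x B Y es); distinct es\<rbrakk> \<Longrightarrow> distinct r"
proof (induction es arbitrary: Y r)
  case (Cons e es)
  then have "r \<in> set_pmf (unmatched x B Y (e # es))" by blast
  then show ?case
  proof (cases rule: unmatched_ConsE)
    case (2 r')
    have "set r' \<subseteq> set es" using unmatched_subset 2(2) .
    then show ?thesis using Cons.IH[OF 2(2)] Cons.prems(2) 2(1) by auto
  qed (use Cons in auto)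
qed auto

lemma expectation_bernoulli_bind:
  fixes h :: "'a \<Rightarrow> real"
  assumes "0 \<le> p" "p \<le> 1" "\<And>b. finite (set_pmf (f b))"
  shows "measure_pmf.expectation (bind_pmf (bernoulli_pmf p) f) h =
    p * measure_pmf.expectation (f True) h + (1 - p) * measure_pmf.expectation (f False) h"
  by (subst pmf_expectation_bind[of UNIV]) (use assms in \<open>auto simp: UNIV_bool\<close>)

definition proper_state :: "real \<Rightarrow> (nat \<Rightarrow> real) \<Rightarrow> bool" where
  "proper_state B Y \<longleftrightarrow> (\<forall>w. 0 \<le> Y w \<and> Y w \<le> B)"

lemma match_prob_pair:
  assumes "u \<noteq> v"
  shows "match_prob x B Y {u, v} =
    (if 0 < Y u \<and> Y u \<le> B * (1 - x * (Y u * Y v)) \<and> 0 < Y v \<and> Y v \<le> B * (1 - x * (Y u * Y v))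
     then x * (Y u * Y v) else 0)"
  using assms by (auto simp: match_prob_def)

lemma match_prob_zero: "v \<in> e \<Longrightarrow> Y v = 0 \<Longrightarrow> match_prob x B Y e = 0"
  by (auto simp: match_prob_def Let_def)

text \<open>Weight 0 marks a matched vertex: \<open>hit\<close> and \<open>miss\<close> keep it at
  0, and \<open>match_prob\<close> vanishes on the edges containing it, so all of these are
  refused.\<close>

lemma unmatched_zero_vertex:
  "\<lbrakk>Y v = 0; r \<in> set_pmf (unmatched x B Y es)\<rbrakk> \<Longrightarrow> filter ((\<in>) v) r = filter ((\<in>) v) es"
proof (induction es arbitrary: Y r)
  case (Cons e es)
  show ?case
  proof (cases "v \<in> e")
    case True
    then have p: "match_prob x B Y e = 0" using Cons.prems match_prob_zero by blast
    have "set_pmf (bernoulli_pmf 0) = {False}"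
      by (auto simp: set_pmf_iff)
    then obtain r' where "r = e # r'" "r' \<in> set_pmf (unmatched x B (miss x B Y e) es)"
      using Cons.prems p by auto
    with Cons.IH[of "miss x B Y e" r'] Cons.prems show ?thesis by (auto simp: miss_def)
  next
    case False
    from Cons.prems(2) show ?thesis
    proof (cases rule: unmatched_ConsE)
      case 1
      then show ?thesis using Cons.IH[OF _ 1] Cons.prems(1) False by (simp add: hit_def)
    next
      case (2 r')
      then show ?thesis using Cons.IH[OF _ 2(2)] Cons.prems(1) False by (simp add: miss_def)
    qed
  qed
qed auto

text \<open>The first edge taken at \<open>v\<close> sets the weight of \<open>v\<close> to 0, after
  which \<open>unmatched_zero_vertex\<close> applies. So the edges taken form a matching.\<close>

lemma unmatched_loses_one:
  assumes "r \<in> set_pmf (unmatched x B Y es)"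
  shows "length (filter ((\<in>) v) es) \<le> Suc (length (filter ((\<in>) v) r))"
  using assms
proof (induction es arbitrary: Y r)
  case (Cons e es)
  then have "r \<in> set_pmf (unmatched x B Y (e # es))" by blast
  then show ?case
  proof (cases rule: unmatched_ConsE)
    case 1
    show ?thesis
    proof (cases "v \<in> e")
      case True
      then show ?thesis using unmatched_zero_vertex[OF _ 1, of v] by (simp add: hit_def)
    next
      case False
      then show ?thesis using Cons.IH[OF 1] by simp
    qed
  next
    case (2 r')
    then show ?thesis using Cons.IH[OF 2(2)] by simp
  qed
qed auto

lemma expect_add: "expect x B Y es (\<lambda>Z. f Z + g Z) = expect x B Y es f + expect x B Y es g"
  by (induction es arbitrary: Y) (auto simp: algebra_simps)

lemma expect_cmult: "expect x B Y es (\<lambda>Z. c * f Z) = c * expect x B Y es f"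
  by (induction es arbitrary: Y) (auto simp: algebra_simps)

section \<open>Neighborhoods, degrees and the potential\<close>

text \<open>In the potential, \<open>es\<close> lists the edges still to come, so this is the set of
  future neighbors of \<open>u\<close>.\<close>

definition nbrs :: "nat \<Rightarrow> edge list \<Rightarrow> nat set" where
  "nbrs u es = {w. {u, w} \<in> set es}"

definition degr :: "nat \<Rightarrow> edge list \<Rightarrow> nat" where
  "degr v es = length (filter ((\<in>) v) es)"

lemma degr_simps [simp]:
  "degr v [] = 0" "degr v (e # es) = (if v \<in> e then Suc (degr v es) else degr v es)"
  by (auto simp: degr_def)

lemma nbrs_Nil [simp]: "nbrs u [] = {}"
  by (simp add: nbrs_def)

lemma nbrs_Cons_same: "nbrs u ({u, w} # es) = insert w (nbrs u es)"
  by (auto simp: nbrs_def doubleton_eq_iff)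

lemma nbrs_Cons_other: "u \<notin> e \<Longrightarrow> nbrs u (e # es) = nbrs u es"
  by (auto simp: nbrs_def)

lemma nbrs_degr: "\<forall>e\<in>set es. card e = 2 \<Longrightarrow> finite (nbrs u es) \<and> card (nbrs u es) \<le> degr u es"
proof (induction es)
  case (Cons e es)
  show ?case
  proof (cases "u \<in> e")
    case True
    then obtain w where "e = {u, w}" using Cons.prems by (auto simp: card_2_iff doubleton_eq_iff)
    with Cons show ?thesis by (auto simp: nbrs_Cons_same card_insert_if)
  qed (use Cons in \<open>auto simp: nbrs_Cons_other\<close>)
qed auto

text \<open>
  A supermartingale under the measure weighted by \<open>Y u * Y v\<close>. The first summand is the
  squared deficit of the predicted final value of \<open>1 / Y u\<close>. The second one pays for its
  quadratic variation: \<open>B * Y w - (Y w)\<^sup>2\<close> loses in the mean what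
  \<open>(Y w)\<^sup>2\<close> gains, and it is nonnegative when \<open>w\<close> leaves the sum.
  The terms with \<open>degr v es\<close> absorb the drift caused by common neighbors of
  \<open>u\<close> and \<open>v\<close>, whose edges to \<open>v\<close> are also never taken.
\<close>

definition potential :: "real \<Rightarrow> real \<Rightarrow> real \<Rightarrow> nat \<Rightarrow> nat \<Rightarrow> edge list \<Rightarrow> (nat \<Rightarrow> real) \<Rightarrow> real" where
  "potential x B a u v es Y =
     (max 0 (a - (1 / Y u - x * (\<Sum>w\<in>nbrs u es. Y w) - 2 * x\<^sup>2 * B^3 * degr v es)))\<^sup>2
     + 2 * x\<^sup>2 * (\<Sum>w\<in>nbrs u es. B * Y w - (Y w)\<^sup>2) + 4 * x^3 * B^4 * degr v es"

lemma max0_power2_mono: "s \<le> (t::real) \<Longrightarrow> (max 0 s)\<^sup>2 \<le> (max 0 t)\<^sup>2"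
  by (intro power_mono) auto

text \<open>Taking expectations, a centered step \<open>t\<close> adds at most its variance.\<close>

lemma max0_power2_add: "(max 0 (s + t))\<^sup>2 \<le> (max 0 s + t :: real)\<^sup>2"
proof (cases "0 \<le> s + t")
  case True
  then show ?thesis by (intro power_mono) auto
qed auto

section \<open>Second moment analysis of one color\<close>

context
  fixes x B :: real
  assumes x_pos: "0 < x" and B_pos: "0 < B" and x_small: "x * B\<^sup>2 \<le> 1 / 2"
begin

lemma proper_state_prod:
  assumes "proper_state B Y"
  shows "0 \<le> x * (Y u * Y v)" "x * (Y u * Y v) \<le> x * B\<^sup>2"
  using assms x_pos B_pos
  by (auto simp: proper_state_def power2_eq_square intro!: mult_left_mono mult_mono mult_nonneg_nonneg)

lemma match_prob_bounds:
  assumes "proper_state B Y" "card e = 2"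
  shows "0 \<le> match_prob x B Y e" "match_prob x B Y e \<le> x * B\<^sup>2" "match_prob x B Y e \<le> 1 / 2"
proof -
  obtain a b where e: "e = {a, b}" "a \<noteq> b" using assms(2) by (auto simp: card_2_iff)
  show "0 \<le> match_prob x B Y e" and *: "match_prob x B Y e \<le> x * B\<^sup>2"
    using proper_state_prod[OF assms(1), of a b] e x_pos by (auto simp: match_prob_pair)
  then show "match_prob x B Y e \<le> 1 / 2" using x_small by linarith
qed

lemma match_prob_le:
  assumes "proper_state B Y" "u \<noteq> v"
  shows "match_prob x B Y {u, v} \<le> x * (Y u * Y v)"
  using proper_state_prod[OF assms(1), of u v] assms(2) by (auto simp: match_prob_pair)

lemma proper_state_hit: "proper_state B Y \<Longrightarrow> proper_state B (hit Y e)"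
  using B_pos by (auto simp: proper_state_def hit_def)

lemma proper_state_miss:
  assumes "proper_state B Y" "card e = 2"
  shows "proper_state B (miss x B Y e)"
proof -
  obtain a b where e: "e = {a, b}" "a \<noteq> b" using assms(2) by (auto simp: card_2_iff)
  have p: "match_prob x B Y e \<le> 1 / 2" by (rule match_prob_bounds[OF assms])
  have "match_prob x B Y e = 0 \<or> (\<forall>w\<in>e. Y w \<le> B * (1 - match_prob x B Y e))"
    using e by (auto simp: match_prob_pair)
  then show ?thesis using assms(1) p
    by (auto simp: proper_state_def miss_def divide_simps)
qed

lemma hit_miss_martingale:
  assumes "proper_state B Y" "card e = 2"
  shows "match_prob x B Y e * hit Y e w + (1 - match_prob x B Y e) * miss x B Y e w = Y w"
proof -
  have "1 - match_prob x B Y e \<noteq> 0" using match_prob_bounds(3)[OF assms] by simp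
  then show ?thesis by (cases "w \<in> e") (simp_all add: hit_def miss_def, simp add: algebra_simps)
qed

lemma expect_mono:
  assumes "proper_state B Y" "\<forall>e\<in>set es. card e = 2" "\<And>Z. proper_state B Z \<Longrightarrow> f Z \<le> g Z"
  shows "expect x B Y es f \<le> expect x B Y es g"
  using assms(1,2)
proof (induction es arbitrary: Y)
  case (Cons e es)
  then have "expect x B (hit Y e) es f \<le> expect x B (hit Y e) es g"
    "expect x B (miss x B Y e) es f \<le> expect x B (miss x B Y e) es g"
    by (auto intro!: Cons.IH proper_state_hit proper_state_miss)
  with match_prob_bounds[OF Cons.prems(1), of e] Cons.prems(2) show ?case
    by (auto intro!: add_mono mult_left_mono)
qed (use assms in auto)

text \<open>Distinctness gives \<open>e\<close> a single chance to be taken, so only the weights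
  just before its arrival count, and \<open>es2\<close> drops out.\<close>

lemma prob_matched:
  assumes "proper_state B Y" "\<forall>f\<in>set (es1 @ e # es2). card f = 2" "distinct (es1 @ e # es2)"
  shows "measure_pmf.expectation (unmatched x B Y (es1 @ e # es2))
      (\<lambda>r. of_bool (e \<notin> set r)) = expect x B Y es1 (\<lambda>Z. match_prob x B Z e)"
  using assms
proof (induction es1 arbitrary: Y)
  case Nil
  note p = match_prob_bounds[OF Nil.prems(1), of e]
  have "measure_pmf.expectation (unmatched x B (hit Y e) es2) (\<lambda>r. of_bool (e \<notin> set r)) =
      measure_pmf.expectation (unmatched x B (hit Y e) es2) (\<lambda>_. 1 :: real)"
    using Nil.prems by (intro integral_cong_AE) (auto simp: AE_measure_pmf_iff dest: unmatched_subset)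
  then show ?case using p Nil.prems
    by (simp add: expectation_bernoulli_bind finite_unmatched)
next
  case (Cons f es1)
  note p = match_prob_bounds[OF Cons.prems(1), of f]
  have "e \<noteq> f" using Cons.prems by auto
  moreover have "proper_state B (hit Y f)" "proper_state B (miss x B Y f)"
    using Cons.prems by (auto intro!: proper_state_hit proper_state_miss)
  ultimately show ?case using p Cons.prems Cons.IH[of "hit Y f"] Cons.IH[of "miss x B Y f"]
    by (simp add: expectation_bernoulli_bind finite_unmatched)
qed

context
  fixes Y :: "nat \<Rightarrow> real" and e :: edge and es :: "edge list" and u v :: nat
  assumes Y: "proper_state B Y" and simple: "\<forall>f\<in>set (e # es). card f = 2"
    and new: "e \<notin> set es" and uv: "u \<noteq> v" "{u, v} \<notin> set (e # es)"
begin

lemma finite_nbrs: "finite (nbrs u es)"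
  using nbrs_degr simple by simp

lemma u_notin_nbrs: "u \<notin> nbrs u es"
  using simple by (auto simp: nbrs_def)

lemma v_notin_nbrs: "v \<notin> nbrs u es"
  using uv by (auto simp: nbrs_def)

lemma Y_bounds: "0 \<le> Y w" "Y w \<le> B"
  using Y by (auto simp: proper_state_def)

lemma edge_prob: "0 \<le> match_prob x B Y e" "match_prob x B Y e \<le> x * B\<^sup>2" "match_prob x B Y e \<le> 1 / 2"
  using match_prob_bounds[OF Y] simple by auto

text \<open>A refusal of \<open>{u, w}\<close> lowers \<open>1 / Y u\<close> by at most
  \<open>x * Y w\<close>, which the prediction had already subtracted for \<open>w\<close>. Capping
  only lessens this decrease, and the deficit is one-sided. When \<open>w\<close> leaves the sum,
  its variance term is nonnegative.\<close>

lemma potential_step_left: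
  assumes "u \<in> e" "0 < Y u"
  shows "potential x B a u v es (miss x B Y e) \<le> potential x B a u v (e # es) Y"
proof -
  obtain w where e: "e = {u, w}" "u \<noteq> w"
    using assms simple by (auto simp: card_2_iff doubleton_eq_iff)
  have w: "w \<noteq> v" "w \<notin> nbrs u es" using e uv new by (auto simp: nbrs_def)
  let ?p = "match_prob x B Y e"
  have S: "(\<Sum>z\<in>nbrs u es. g (miss x B Y e z)) = (\<Sum>z\<in>nbrs u es. g (Y z))" for g :: "real \<Rightarrow> real"
    using e w u_notin_nbrs by (intro sum.cong) (auto simp: miss_def)
  have "?p \<le> x * (Y u * Y w)"
    using match_prob_le[OF Y] e by auto
  then have "?p / Y u \<le> x * Y w" using assms(2) by (simp add: field_simps)
  moreover have "1 / miss x B Y e u = 1 / Y u - ?p / Y u"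
    using e by (simp add: miss_def diff_divide_distrib)
  ultimately have inv: "1 / Y u - x * Y w \<le> 1 / miss x B Y e u" by linarith
  have "0 \<le> B * Y w - (Y w)\<^sup>2"
    using Y_bounds[of w] by (simp add: power2_eq_square mult_right_mono)
  then have nonneg: "0 \<le> 2 * x\<^sup>2 * (B * Y w - (Y w)\<^sup>2)" by simp
  have "(max 0 (a - (1 / miss x B Y e u - x * (\<Sum>w\<in>nbrs u es. Y w) - 2 * x\<^sup>2 * B^3 * degr v es)))\<^sup>2
    \<le> (max 0 (a - (1 / Y u - x * (Y w + (\<Sum>w\<in>nbrs u es. Y w)) - 2 * x\<^sup>2 * B^3 * degr v es)))\<^sup>2"
    using inv by (intro max0_power2_mono) (simp add: algebra_simps)
  moreover have "potential x B a u v (e # es) Y =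
      (max 0 (a - (1 / Y u - x * (Y w + (\<Sum>w\<in>nbrs u es. Y w)) - 2 * x\<^sup>2 * B^3 * degr v es)))\<^sup>2
      + (2 * x\<^sup>2 * (B * Y w - (Y w)\<^sup>2) + 2 * x\<^sup>2 * (\<Sum>w\<in>nbrs u es. B * Y w - (Y w)\<^sup>2))
      + 4 * x^3 * B^4 * degr v es"
    unfolding potential_def distrib_left[symmetric]
    using e w uv(1) finite_nbrs by (simp add: nbrs_Cons_same)
  ultimately show ?thesis using nonneg
    unfolding potential_def S[of "\<lambda>y. y"] S[of "\<lambda>y. B * y - y\<^sup>2"] by linarith
qed

text \<open>If the other endpoint \<open>w\<close> is a future neighbor of \<open>u\<close>, its
  weight grows by at most \<open>2 * x * B^3\<close>. This moves the prediction by
  \<open>2 * x^2 * B^3\<close> and the variance sum by \<open>4 * x^3 * B^4\<close>, exactly what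
  one unit of \<open>degr v\<close> pays for.\<close>

lemma potential_step_right:
  assumes "v \<in> e" "u \<notin> e"
  shows "potential x B a u v es (miss x B Y e) \<le> potential x B a u v (e # es) Y"
proof -
  obtain w where e: "e = {v, w}" "v \<noteq> w" "w \<noteq> u"
    using assms simple by (auto simp: card_2_iff doubleton_eq_iff)
  let ?p = "match_prob x B Y e" and ?Z = "miss x B Y e" and ?N = "nbrs u es"
  have Zu: "?Z u = Y u" using assms by (simp add: miss_def)
  have ge: "Y z \<le> ?Z z" for z
    using edge_prob Y_bounds[of z] by (auto simp: miss_def divide_simps intro!: mult_left_le)
  have "?Z z - Y z \<le> (if z = w then 2 * x * B^3 else 0)" if "z \<in> ?N" for z
  proof (cases "z = w")
    case True
    have "?Z w - Y w = Y w * (?p / (1 - ?p))"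
      using e edge_prob by (simp add: miss_def field_simps)
    also have "\<dots> \<le> B * (2 * (x * B\<^sup>2))"
    proof (rule mult_mono)
      have "?p / (1 - ?p) \<le> 2 * ?p"
        using edge_prob mult_left_mono[OF edge_prob(3) edge_prob(1)]
        by (simp add: divide_simps) (simp add: algebra_simps)
      also have "\<dots> \<le> 2 * (x * B\<^sup>2)" using edge_prob by simp
      finally show "?p / (1 - ?p) \<le> 2 * (x * B\<^sup>2)" .
    qed (use edge_prob Y_bounds B_pos in auto)
    finally show ?thesis using True by (simp add: power2_eq_square power3_eq_cube algebra_simps)
  next
    case False
    then show ?thesis using that e v_notin_nbrs by (auto simp: miss_def)
  qed
  then have "(\<Sum>z\<in>?N. ?Z z - Y z) \<le> (\<Sum>z\<in>?N. if z = w then 2 * x * B^3 else 0)"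
    by (rule sum_mono)
  also have "\<dots> \<le> 2 * x * B^3" using finite_nbrs x_pos B_pos by simp
  finally have \<delta>: "(\<Sum>z\<in>?N. ?Z z) - (\<Sum>z\<in>?N. Y z) \<le> 2 * x * B^3"
    by (simp add: sum_subtractf)
  have "(\<Sum>z\<in>?N. B * ?Z z - (?Z z)\<^sup>2) \<le> (\<Sum>z\<in>?N. (B * Y z - (Y z)\<^sup>2) + B * (?Z z - Y z))"
    using ge Y_bounds by (intro sum_mono) (auto simp: algebra_simps intro!: power_mono)
  also have "\<dots> = (\<Sum>z\<in>?N. B * Y z - (Y z)\<^sup>2) + B * ((\<Sum>z\<in>?N. ?Z z) - (\<Sum>z\<in>?N. Y z))"
    by (simp add: sum.distrib sum_subtractf sum_distrib_left algebra_simps)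
  also have "\<dots> \<le> (\<Sum>z\<in>?N. B * Y z - (Y z)\<^sup>2) + B * (2 * x * B^3)"
    using \<delta> B_pos by simp
  finally have "2 * x\<^sup>2 * (\<Sum>z\<in>?N. B * ?Z z - (?Z z)\<^sup>2)
      \<le> 2 * x\<^sup>2 * ((\<Sum>z\<in>?N. B * Y z - (Y z)\<^sup>2) + B * (2 * x * B^3))"
    by (rule mult_left_mono) simp
  also have "\<dots> = 2 * x\<^sup>2 * (\<Sum>z\<in>?N. B * Y z - (Y z)\<^sup>2) + 4 * x^3 * B^4"
    by (simp add: algebra_simps power2_eq_square power3_eq_cube power4_eq_xxxx)
  finally have variance: "2 * x\<^sup>2 * (\<Sum>z\<in>?N. B * ?Z z - (?Z z)\<^sup>2)
      \<le> 2 * x\<^sup>2 * (\<Sum>z\<in>?N. B * Y z - (Y z)\<^sup>2) + 4 * x^3 * B^4" .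
  have "x * ((\<Sum>z\<in>?N. ?Z z) - (\<Sum>z\<in>?N. Y z)) \<le> x * (2 * x * B^3)"
    using \<delta> x_pos by (intro mult_left_mono) auto
  then have drift: "(max 0 (a - (1 / Y u - x * (\<Sum>w\<in>?N. ?Z w) - 2 * x\<^sup>2 * B^3 * degr v es)))\<^sup>2
    \<le> (max 0 (a - (1 / Y u - x * (\<Sum>w\<in>?N. Y w) - 2 * x\<^sup>2 * B^3 * (degr v es + 1))))\<^sup>2"
    by (intro max0_power2_mono) (simp add: algebra_simps power2_eq_square)
  have "4 * x^3 * B^4 * degr v (e # es) = 4 * x^3 * B^4 + 4 * x^3 * B^4 * degr v es"
    "real (degr v (e # es)) = degr v es + 1"
    using assms(1) by (simp_all add: algebra_simps)
  then show ?thesis unfolding potential_def Zu nbrs_Cons_other[OF assms(2)]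
    using drift variance by (simp only:)
qed

text \<open>Both outcomes keep their original probabilities here. The change \<open>\<delta>\<close>
  of the predicted sum is centered, so the squared deficit grows in the mean by at most the mean of
  \<open>x^2 * \<delta>^2\<close>, and by \<open>VW\<close> the second summand of the potential
  loses enough to pay for it.\<close>

lemma potential_step_other:
  assumes "u \<notin> e" "v \<notin> e"
  shows "match_prob x B Y e * potential x B a u v es (hit Y e)
    + (1 - match_prob x B Y e) * potential x B a u v es (miss x B Y e)
    \<le> potential x B a u v (e # es) Y"
proof -
  let ?p = "match_prob x B Y e" and ?N = "nbrs u es"
  define Z where "Z b = (if b then hit Y e else miss x B Y e)" for b
  have mart: "?p * Z True w + (1 - ?p) * Z False w = Y w" for w
    using hit_miss_martingale[OF Y] simple by (simp add: Z_def)
  have Zu: "Z b u = Y u" for b using assms by (simp add: Z_def hit_def miss_def)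
  define s where "s = max 0 (a - (1 / Y u - x * (\<Sum>w\<in>?N. Y w) - 2 * x\<^sup>2 * B^3 * degr v es))"
  define \<delta> where "\<delta> b = (\<Sum>w\<in>?N. Z b w - Y w)" for b
  define V where "V b = (\<Sum>w\<in>?N. (Z b w - Y w)\<^sup>2)" for b
  define W where "W b = (\<Sum>w\<in>?N. B * Z b w - (Z b w)\<^sup>2)" for b
  define R where "R = 4 * x^3 * B^4 * degr v es"
  have card_e: "finite e" "card e = 2" using simple by (auto simp: card_ge_0_finite)
  \<comment> \<open>Only the two endpoints of \<open>e\<close> change their weights, so
    Cauchy-Schwarz costs a factor 2; this is the 2 in the variance term of
    \<open>potential\<close>.\<close>
  have \<delta>_sq: "(\<delta> b)\<^sup>2 \<le> 2 * V b" for b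
  proof -
    have same: "Z b w = Y w" if "w \<notin> e" for w using that by (simp add: Z_def hit_def miss_def)
    have "\<delta> b = (\<Sum>w\<in>?N \<inter> e. Z b w - Y w)" unfolding \<delta>_def
      using finite_nbrs same by (intro sum.mono_neutral_right) auto
    then have "(\<delta> b)\<^sup>2 \<le> (\<Sum>w\<in>?N \<inter> e. (Z b w - Y w)\<^sup>2) * card (?N \<inter> e)"
      using sum_squared_le_sum_of_squares[of "\<lambda>w. Z b w - Y w" "?N \<inter> e"] by simp
    also have "\<dots> \<le> (\<Sum>w\<in>?N \<inter> e. (Z b w - Y w)\<^sup>2) * 2"
      using card_mono[of e "?N \<inter> e"] card_e by (intro mult_left_mono sum_nonneg) auto
    also have "(\<Sum>w\<in>?N \<inter> e. (Z b w - Y w)\<^sup>2) = V b" unfolding V_def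
      using finite_nbrs same by (intro sum.mono_neutral_left) auto
    finally show ?thesis by simp
  qed
  have pot: "potential x B a u v es (Z b) \<le> (s + x * \<delta> b)\<^sup>2 + 2 * x\<^sup>2 * W b + R" for b
  proof -
    have "(\<Sum>w\<in>?N. Z b w) = (\<Sum>w\<in>?N. Y w) + \<delta> b" by (simp add: \<delta>_def sum_subtractf)
    then show ?thesis
      using max0_power2_add[of "a - (1 / Y u - x * (\<Sum>w\<in>?N. Y w) - 2 * x\<^sup>2 * B^3 * degr v es)" "x * \<delta> b"]
      unfolding potential_def Zu s_def W_def R_def by (simp add: algebra_simps)
  qed
  have \<delta>_mean: "?p * \<delta> True + (1 - ?p) * \<delta> False = 0"
  proof -
    have "?p * \<delta> True + (1 - ?p) * \<delta> False =
        (\<Sum>w\<in>?N. (?p * Z True w + (1 - ?p) * Z False w) - Y w)"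
      unfolding \<delta>_def sum_distrib_left sum.distrib[symmetric] by (intro sum.cong) (auto simp: algebra_simps)
    then show ?thesis by (simp add: mart)
  qed
  have VW: "?p * (V True + W True) + (1 - ?p) * (V False + W False) = (\<Sum>w\<in>?N. B * Y w - (Y w)\<^sup>2)"
  proof -
    have "?p * (V True + W True) + (1 - ?p) * (V False + W False) =
        (\<Sum>w\<in>?N. (B - 2 * Y w) * (?p * Z True w + (1 - ?p) * Z False w) + (Y w)\<^sup>2)"
      unfolding V_def W_def sum_distrib_left sum.distrib[symmetric]
      by (intro sum.cong) (auto simp: algebra_simps power2_eq_square)
    also have "\<dots> = (\<Sum>w\<in>?N. B * Y w - (Y w)\<^sup>2)"
      unfolding mart by (intro sum.cong) (auto simp: algebra_simps power2_eq_square)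
    finally show ?thesis .
  qed
  have b: "potential x B a u v es (Z b) \<le> s\<^sup>2 + 2 * s * x * \<delta> b + 2 * x\<^sup>2 * (V b + W b) + R" for b
  proof -
    have "x\<^sup>2 * (\<delta> b)\<^sup>2 \<le> x\<^sup>2 * (2 * V b)" using \<delta>_sq by (intro mult_left_mono) auto
    with pot[of b] show ?thesis by (simp add: algebra_simps power2_eq_square)
  qed
  have "?p * potential x B a u v es (Z True) + (1 - ?p) * potential x B a u v es (Z False)
    \<le> ?p * (s\<^sup>2 + 2 * s * x * \<delta> True + 2 * x\<^sup>2 * (V True + W True) + R)
      + (1 - ?p) * (s\<^sup>2 + 2 * s * x * \<delta> False + 2 * x\<^sup>2 * (V False + W False) + R)"
    using edge_prob b by (intro add_mono mult_left_mono) auto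
  also have "\<dots> = s\<^sup>2 + 2 * s * x * (?p * \<delta> True + (1 - ?p) * \<delta> False)
      + 2 * x\<^sup>2 * (?p * (V True + W True) + (1 - ?p) * (V False + W False)) + R"
    by (simp add: algebra_simps)
  also have "\<dots> = potential x B a u v (e # es) Y"
    unfolding \<delta>_mean VW unfolding potential_def nbrs_Cons_other[OF assms(1)] s_def R_def
    using assms by simp
  finally show ?thesis by (simp add: Z_def)
qed

end

text \<open>Induction with the three step lemmas. If \<open>e\<close> contains \<open>u\<close> or
  \<open>v\<close>, the factor \<open>Z u * Z v\<close> is 0 after a hit, and after a miss its
  denominator cancels the probability of the miss, so only the refusal counts. With no edges left,
  the potential is the squared deficit.\<close>

lemma expect_weighted_potential:
  assumes "proper_state B Y" "\<forall>f\<in>set es. card f = 2" "distinct es" "u \<noteq> v" "{u, v} \<notin> set es"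
  shows "expect x B Y es (\<lambda>Z. Z u * Z v * (max 0 (a - 1 / Z u))\<^sup>2)
    \<le> Y u * Y v * potential x B a u v es Y"
  using assms
proof (induction es arbitrary: Y)
  case (Cons e es)
  let ?p = "match_prob x B Y e" and ?H = "hit Y e" and ?M = "miss x B Y e"
  let ?\<Phi> = "\<lambda>Z. Z u * Z v * potential x B a u v es Z"
  have p: "0 \<le> ?p" "?p \<le> 1 / 2"
    using match_prob_bounds[OF Cons.prems(1), of e] Cons.prems by auto
  have state: "proper_state B ?H" "proper_state B ?M"
    using Cons.prems
    by (auto intro!: proper_state_hit proper_state_miss)
  note step = potential_step_left potential_step_right potential_step_other
  have prems: "proper_state B Y" "\<forall>f\<in>set (e # es). card f = 2" "e \<notin> set es"
     "u \<noteq> v" "{u, v} \<notin> set (e # es)" using Cons.prems by auto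
  have pos: "0 \<le> Y u" "0 \<le> Y v" using Cons.prems by (auto simp: proper_state_def)
  have "expect x B Y (e # es) (\<lambda>Z. Z u * Z v * (max 0 (a - 1 / Z u))\<^sup>2)
    \<le> ?p * ?\<Phi> ?H + (1 - ?p) * ?\<Phi> ?M"
    using Cons.IH[OF state(1)] Cons.IH[OF state(2)] Cons.prems p
    by (auto intro!: add_mono mult_left_mono)
  also have "\<dots> \<le> Y u * Y v * potential x B a u v (e # es) Y"
  proof (cases "Y u = 0")
    case True
    \<comment> \<open>Here \<open>1 / Y u\<close> is the default value 0, but the factor
      \<open>Y u\<close> makes both sides 0.\<close>
    then show ?thesis by (simp add: hit_def miss_def)
  next
    case False
    consider "u \<in> e" | "u \<notin> e" "v \<in> e" | "u \<notin> e" "v \<notin> e" by blast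
    then show ?thesis
    proof cases
      case 1
      then have "v \<notin> e" using Cons.prems by (auto simp: card_2_iff doubleton_eq_iff)
      then have "?p * ?\<Phi> ?H + (1 - ?p) * ?\<Phi> ?M = Y u * Y v * potential x B a u v es ?M"
        using 1 p by (simp add: hit_def miss_def)
      also have "\<dots> \<le> Y u * Y v * potential x B a u v (e # es) Y"
        using potential_step_left[OF prems 1] False pos by (intro mult_left_mono) auto
      finally show ?thesis .
    next
      case 2
      then have "?p * ?\<Phi> ?H + (1 - ?p) * ?\<Phi> ?M = Y u * Y v * potential x B a u v es ?M"
        using p by (simp add: hit_def miss_def)
      also have "\<dots> \<le> Y u * Y v * potential x B a u v (e # es) Y"
        using potential_step_right[OF prems 2(2,1)] pos by (intro mult_left_mono) auto
      finally show ?thesis .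
    next
      case 3
      then have "?p * ?\<Phi> ?H + (1 - ?p) * ?\<Phi> ?M = Y u * Y v *
          (?p * potential x B a u v es ?H + (1 - ?p) * potential x B a u v es ?M)"
        using p by (simp add: hit_def miss_def algebra_simps)
      also have "\<dots> \<le> Y u * Y v * potential x B a u v (e # es) Y"
        using potential_step_other[OF prems 3] pos by (intro mult_left_mono) auto
      finally show ?thesis .
    qed
  qed
  finally show ?case .
qed (simp add: potential_def)

text \<open>The change of measure conserves its total mass: as \<open>{u, v}\<close> has not
  arrived, each edge changes at most one factor of the product, and that factor is a
  martingale.\<close>

lemma expect_weight:
  assumes "proper_state B Y" "\<forall>f\<in>set es. card f = 2" "u \<noteq> v" "{u, v} \<notin> set es"
  shows "expect x B Y es (\<lambda>Z. Z u * Z v) = Y u * Y v"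
  using assms
proof (induction es arbitrary: Y)
  case (Cons e es)
  let ?p = "match_prob x B Y e" and ?H = "hit Y e" and ?M = "miss x B Y e"
  have p: "0 \<le> ?p" "?p \<le> 1 / 2"
    using match_prob_bounds[OF Cons.prems(1), of e] Cons.prems by auto
  have state: "proper_state B ?H" "proper_state B ?M"
    using Cons.prems
    by (auto intro!: proper_state_hit proper_state_miss)
  have "1 - ?p \<noteq> 0" using p by simp
  have "\<not> (u \<in> e \<and> v \<in> e)" using Cons.prems by (auto simp: card_2_iff doubleton_eq_iff)
  then consider "u \<in> e" "v \<notin> e" | "u \<notin> e" "v \<in> e" | "u \<notin> e" "v \<notin> e" by blast
  then have "?p * (?H u * ?H v) + (1 - ?p) * (?M u * ?M v) = Y u * Y v"
    by cases (use \<open>1 - ?p \<noteq> 0\<close> in \<open>simp_all add: hit_def miss_def\<close>, simp add: algebra_simps)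
  then show ?case using Cons.IH[OF state(1)] Cons.IH[OF state(2)] Cons.prems by simp
qed simp

text \<open>
  If the edge is capped at \<open>u\<close> or \<open>v\<close>, then the corresponding error term
  is at least \<open>x * (Y u * Y v)\<close> (Chebyshev's inequality).
\<close>

lemma match_prob_ge:
  assumes "proper_state B Y" "u \<noteq> v" "0 < \<gamma>" "1 / (B * (1 - x * B\<^sup>2)) + \<gamma> \<le> a"
  shows "x * (Y u * Y v) - x / \<gamma>\<^sup>2 * (Y u * Y v * (max 0 (a - 1 / Y u))\<^sup>2)
    - x / \<gamma>\<^sup>2 * (Y v * Y u * (max 0 (a - 1 / Y v))\<^sup>2) \<le> match_prob x B Y {u, v}"
proof -
  have Y: "0 \<le> Y u" "0 \<le> Y v" using assms(1) by (auto simp: proper_state_def)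
  show ?thesis
  proof (cases "Y u = 0 \<or> Y v = 0")
    case True
    then show ?thesis using assms(2) by (auto simp: match_prob_pair)
  next
    case False
    then have pos: "0 < Y u" "0 < Y v" using Y by auto
    have err: "0 \<le> x / \<gamma>\<^sup>2 * (Y u * Y v * (max 0 (a - 1 / Y u))\<^sup>2)"
      "0 \<le> x / \<gamma>\<^sup>2 * (Y v * Y u * (max 0 (a - 1 / Y v))\<^sup>2)"
      using Y x_pos by auto
    have large: "1 \<le> (max 0 (a - 1 / y))\<^sup>2 / \<gamma>\<^sup>2" if "B * (1 - x * (Y u * Y v)) < y" for y
    proof -
      have "B * (1 - x * B\<^sup>2) \<le> B * (1 - x * (Y u * Y v))"
        using B_pos proper_state_prod(2)[OF assms(1), of u v]
        by (intro mult_left_mono) auto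
      moreover have "0 < B * (1 - x * B\<^sup>2)" using B_pos x_small by simp
      ultimately have "1 / y \<le> 1 / (B * (1 - x * B\<^sup>2))" using that by (intro divide_left_mono) auto
      then have "\<gamma> \<le> max 0 (a - 1 / y)" using assms(4) by linarith
      then have "\<gamma>\<^sup>2 \<le> (max 0 (a - 1 / y))\<^sup>2" using assms(3) by (intro power_mono) auto
      then show ?thesis using assms(3) by (simp add: divide_simps)
    qed
    show ?thesis
    proof (cases "Y u \<le> B * (1 - x * (Y u * Y v)) \<and> Y v \<le> B * (1 - x * (Y u * Y v))")
      case True
      then show ?thesis using pos assms(2) err by (simp add: match_prob_pair)
    next
      case capped: False
      have "x * (Y u * Y v) \<le> x / \<gamma>\<^sup>2 * (Y u * Y v * (max 0 (a - 1 / Y u))\<^sup>2)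
        \<or> x * (Y u * Y v) \<le> x / \<gamma>\<^sup>2 * (Y v * Y u * (max 0 (a - 1 / Y v))\<^sup>2)"
      proof (cases "Y u \<le> B * (1 - x * (Y u * Y v))")
        case False
        then have "x * (Y u * Y v) * 1 \<le> x * (Y u * Y v) * ((max 0 (a - 1 / Y u))\<^sup>2 / \<gamma>\<^sup>2)"
          using large[of "Y u"] x_pos pos by (intro mult_left_mono) auto
        then show ?thesis by (simp add: algebra_simps)
      next
        case True
        then have "x * (Y u * Y v) * 1 \<le> x * (Y u * Y v) * ((max 0 (a - 1 / Y v))\<^sup>2 / \<gamma>\<^sup>2)"
          using large[of "Y v"] capped x_pos pos by (intro mult_left_mono) auto
        then show ?thesis by (simp add: algebra_simps)
      qed
      moreover have "0 \<le> match_prob x B Y {u, v}"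
        using assms by (intro match_prob_bounds) auto
      ultimately show ?thesis using err by linarith
    qed
  qed
qed

text \<open>The threshold is the smallest possible initial prediction, so the squared deficit starts
  at 0 and only the variance terms remain.\<close>

lemma potential_initial:
  fixes d :: real
  assumes "\<forall>f\<in>set es. card f = 2" "degr u es \<le> d" "degr v es \<le> d" "1 \<le> B"
  shows "potential x B (1 - x * d - 2 * x\<^sup>2 * B^3 * d) u v es (\<lambda>_. 1)
    \<le> 2 * x\<^sup>2 * B * d + 4 * x^3 * B^4 * d"
proof -
  have N: "real (card (nbrs u es)) \<le> d" using nbrs_degr[OF assms(1), of u] assms(2) by linarith
  have d: "0 \<le> d" using assms(2) by linarith
  have "x * card (nbrs u es) \<le> x * d" using N x_pos by simp
  moreover have "2 * x\<^sup>2 * B^3 * degr v es \<le> 2 * x\<^sup>2 * B^3 * d"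
    using assms(3) x_pos B_pos by (intro mult_left_mono) auto
  ultimately have "max 0 (1 - x * d - 2 * x\<^sup>2 * B^3 * d -
      (1 / 1 - x * (\<Sum>w\<in>nbrs u es. 1) - 2 * x\<^sup>2 * B^3 * degr v es)) = 0"
    by simp
  moreover have "2 * x\<^sup>2 * (\<Sum>w\<in>nbrs u es. B * 1 - 1\<^sup>2) \<le> 2 * x\<^sup>2 * (d * B)"
    using assms(4) N d by (intro mult_left_mono) (auto intro!: mult_mono)
  moreover have "4 * x^3 * B^4 * degr v es \<le> 4 * x^3 * B^4 * d"
    using assms(3) x_pos B_pos by (intro mult_left_mono) auto
  ultimately show ?thesis unfolding potential_def by (simp add: algebra_simps)
qed

text \<open>The uncapped probability has mean exactly \<open>x\<close>, and
  \<open>match_prob_ge\<close> subtracts one error term for each endpoint. By \<open>gap\<close>,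
  the worst prediction exceeds by \<open>\<gamma>\<close> the level of \<open>1 / Y u\<close> at
  which the cap can act.\<close>

lemma prob_matched_ge:
  fixes d :: real
  assumes es: "\<forall>f\<in>set es. card f = 2" "distinct es" "\<And>v. degr v es \<le> d" "e \<in> set es"
    and B: "1 \<le> B" and \<gamma>: "0 < \<gamma>"
    and gap: "1 / (B * (1 - x * B\<^sup>2)) + \<gamma> \<le> 1 - x * d - 2 * x\<^sup>2 * B^3 * d"
  shows "x * (1 - (4 * x\<^sup>2 * B * d + 8 * x^3 * B^4 * d) / \<gamma>\<^sup>2)
    \<le> measure_pmf.expectation (unmatched x B (\<lambda>_. 1) es) (\<lambda>r. of_bool (e \<notin> set r))"
proof -
  obtain es1 es2 where split: "es = es1 @ e # es2" using es(4) by (auto simp: in_set_conv_decomp)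
  obtain u v where e: "e = {u, v}" "u \<noteq> v" using es(1,4) by (auto simp: card_2_iff)
  let ?Y = "\<lambda>_::nat. 1::real" and ?E = "expect x B (\<lambda>_. 1) es1"
  define a where "a = 1 - x * d - 2 * x\<^sup>2 * B^3 * d"
  define K where "K = 2 * x\<^sup>2 * B * d + 4 * x^3 * B^4 * d"
  define F where "F u v Z = Z u * Z v * (max 0 (a - 1 / Z u))\<^sup>2" for u v :: nat and Z :: "nat \<Rightarrow> real"
  have Y: "proper_state B ?Y" using B by (simp add: proper_state_def)
  have es1: "\<forall>f\<in>set es1. card f = 2" "distinct es1" "{u, v} \<notin> set es1" "{v, u} \<notin> set es1"
    using es(1,2) split e by (auto simp: insert_commute)
  have deg: "degr w es1 \<le> d" for w
  proof -
    have "degr w es1 \<le> degr w es" by (simp add: degr_def split)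
    then show ?thesis using es(3)[of w] by linarith
  qed
  have F: "?E (F u v) \<le> K" if "u \<noteq> v" "{u, v} \<notin> set es1" for u v
  proof -
    have "?E (F u v) \<le> 1 * 1 * potential x B a u v es1 ?Y"
      unfolding F_def using that es1 Y by (intro expect_weighted_potential)
    also have "\<dots> \<le> K" using potential_initial[OF es1(1) deg deg B] by (simp add: a_def K_def)
    finally show ?thesis .
  qed
  have "x * (1 - (4 * x\<^sup>2 * B * d + 8 * x^3 * B^4 * d) / \<gamma>\<^sup>2) = x - x / \<gamma>\<^sup>2 * K - x / \<gamma>\<^sup>2 * K"
    by (simp add: K_def algebra_simps add_divide_distrib diff_divide_distrib)
  also have "\<dots> \<le> x - x / \<gamma>\<^sup>2 * ?E (F u v) - x / \<gamma>\<^sup>2 * ?E (F v u)"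
  proof -
    have "x / \<gamma>\<^sup>2 * ?E (F u v) \<le> x / \<gamma>\<^sup>2 * K" "x / \<gamma>\<^sup>2 * ?E (F v u) \<le> x / \<gamma>\<^sup>2 * K"
      using F[OF e(2) es1(3)] F[OF e(2)[symmetric] es1(4)] x_pos by (intro mult_left_mono; simp)+
    then show ?thesis by (intro diff_mono) auto
  qed
  also have "\<dots> = ?E (\<lambda>Z. x * (Z u * Z v) + ((- (x / \<gamma>\<^sup>2)) * F u v Z + (- (x / \<gamma>\<^sup>2)) * F v u Z))"
    unfolding expect_add expect_cmult
    using expect_weight[OF Y es1(1) e(2) es1(3)] by simp
  also have "\<dots> \<le> ?E (\<lambda>Z. match_prob x B Z e)"
  proof (rule expect_mono[OF Y es1(1)])
    fix Z assume "proper_state B Z"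
    from match_prob_ge[OF this e(2) \<gamma> gap]
    show "x * (Z u * Z v) + ((- (x / \<gamma>\<^sup>2)) * F u v Z + (- (x / \<gamma>\<^sup>2)) * F v u Z) \<le> match_prob x B Z e"
      by (simp add: F_def a_def e(1))
  qed
  also have "\<dots> = measure_pmf.expectation (unmatched x B ?Y es) (\<lambda>r. of_bool (e \<notin> set r))"
    unfolding split using es Y split by (intro prob_matched[symmetric]) auto
  finally show ?thesis .
qed

end

section \<open>Parameters of one color in terms of its degree bound\<close>

text \<open>Write \<open>s\<close> for the slack. Since \<open>1 - rate d * d\<close> is at least
  \<open>s / 2\<close>, the predicted \<open>1 / Y u\<close> stays of order \<open>s\<close>, well
  above \<open>1 / cap d = s / 8\<close>. The relative loss by Chebyshev is of order
  \<open>1 / (d * s^3)\<close>; it is at most \<open>s\<close> when \<open>d * s^4\<close> is a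
  large constant, whence the exponent \<open>- 1 / 4\<close>.\<close>

definition slack :: "real \<Rightarrow> real" where "slack d = 10 * d powr (- 1 / 4)"
definition rate :: "real \<Rightarrow> real" where "rate d = 1 / ((1 + slack d) * d)"
definition cap :: "real \<Rightarrow> real" where "cap d = 8 / slack d"

lemma slack_bounds:
  assumes "10000 \<le> d"
  shows "0 < slack d" "slack d \<le> 1" "d * slack d ^ 4 = 10000"
proof -
  show "0 < slack d" using assms by (simp add: slack_def)
  have "d powr (- 1 / 4) \<le> 10000 powr (- 1 / 4)" using assms by (intro powr_mono2') auto
  also have "(10000::real) powr (- 1 / 4) = (10 powr 4) powr (- 1 / 4)" by simp
  also have "\<dots> = 1 / 10" unfolding powr_powr by (simp add: powr_minus)
  finally show "slack d \<le> 1" by (simp add: slack_def)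
  have "(d powr (- 1 / 4)) ^ 4 = d powr (- 1)"
    using assms by (simp add: powr_realpow[symmetric] powr_powr)
  then show "d * slack d ^ 4 = 10000" using assms by (simp add: slack_def power_mult_distrib powr_minus)
qed

lemma layer_matches:
  fixes d :: real
  assumes es: "\<forall>f\<in>set es. card f = 2" "distinct es" "\<And>v. degr v es \<le> d" "e \<in> set es"
    and d: "10000 \<le> d"
  shows "(1 - 2 * slack d) / d
    \<le> measure_pmf.expectation (unmatched (rate d) (cap d) (\<lambda>_. 1) es) (\<lambda>r. of_bool (e \<notin> set r))"
proof -
  define s where "s = slack d"
  define x where "x = rate d"
  define B where "B = cap d"
  have s: "0 < s" "s \<le> 1" "d * s ^ 4 = 10000" using slack_bounds[OF d] by (auto simp: s_def)
  have d0: "0 < d" using d by simp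
  have Bs: "B = 8 / s" by (simp add: B_def cap_def s_def)
  have xd: "x * d = 1 / (1 + s)" using d0 s by (simp add: x_def rate_def s_def)
  have x_pos: "0 < x" using d0 s by (simp add: x_def rate_def s_def)
  have B: "0 < B" "1 \<le> B" using s by (auto simp: Bs divide_simps)
  have dinv: "1 / d = s ^ 4 / 10000" using s d0 by (simp add: field_simps)
  have x_le: "x \<le> s ^ 4 / 10000"
  proof -
    have "x \<le> 1 / d" unfolding x_def rate_def s_def[symmetric]
      using d0 s by (intro divide_left_mono) auto
    then show ?thesis using dinv by simp
  qed
  have xd_le: "x * d \<le> 1 - s / 2" unfolding xd using s by (simp add: divide_simps) (simp add: algebra_simps mult_left_le)
  have xd_le1: "x * d \<le> 1" using xd_le s by simp
  have xB: "x * B\<^sup>2 \<le> s\<^sup>2 / 100"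
  proof -
    have "x * B\<^sup>2 \<le> s ^ 4 / 10000 * B\<^sup>2" using x_le by (intro mult_right_mono) auto
    also have "\<dots> = 64 * s\<^sup>2 / 10000" using s by (simp add: Bs field_simps eval_nat_numeral)
    also have "\<dots> \<le> s\<^sup>2 / 100" by simp
    finally show ?thesis .
  qed
  have s2: "s\<^sup>2 \<le> 1" using s by (simp add: power_le_one)
  have small: "x * B\<^sup>2 \<le> 1 / 2" using xB s2 by linarith
  have xB3: "x * B ^ 3 \<le> 512 * s / 10000"
  proof -
    have "x * B ^ 3 \<le> s ^ 4 / 10000 * B ^ 3" using x_le B by (intro mult_right_mono) auto
    also have "\<dots> = 512 * s / 10000" using s by (simp add: Bs field_simps eval_nat_numeral)
    finally show ?thesis .
  qed
  have drift: "2 * x\<^sup>2 * B ^ 3 * d \<le> 1024 * s / 10000"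
  proof -
    have "2 * x\<^sup>2 * B ^ 3 * d = 2 * (x * B ^ 3) * (x * d)" by (simp add: power2_eq_square)
    also have "\<dots> \<le> 2 * (512 * s / 10000) * 1"
      using xB3 xd_le1 x_pos d0 B s by (intro mult_mono) auto
    finally show ?thesis by simp
  qed
  have "1 / (B * (1 - x * B\<^sup>2)) \<le> 1 / (B * (1 / 2))"
    using small B by (intro divide_left_mono mult_left_mono) auto
  then have b: "1 / (B * (1 - x * B\<^sup>2)) \<le> s / 4" by (simp add: Bs)
  \<comment> \<open>Of the margin \<open>s / 2\<close> left by \<open>xd_le\<close>, the cap takes
    \<open>s / 4\<close>, the deviation \<open>s / 8\<close> and the drift at most
    \<open>0.1024 * s\<close>.\<close>
  have gap: "1 / (B * (1 - x * B\<^sup>2)) + s / 8 \<le> 1 - x * d - 2 * x\<^sup>2 * B^3 * d"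
    using b drift xd_le s by linarith
  have loss: "(4 * x\<^sup>2 * B * d + 8 * x^3 * B^4 * d) / (s / 8)\<^sup>2 \<le> s"
  proof -
    have "x * B \<le> 8 * s ^ 3 / 10000"
    proof -
      have "x * B \<le> s ^ 4 / 10000 * B" using x_le B by (intro mult_right_mono) auto
      also have "\<dots> = 8 * s ^ 3 / 10000" using s by (simp add: Bs field_simps eval_nat_numeral)
      finally show ?thesis .
    qed
    then have "(x * d) * (4 * (x * B)) \<le> 1 * (4 * (8 * s ^ 3 / 10000))"
      using xd_le1 x_pos d0 B s by (intro mult_mono) auto
    moreover have "(x * d) * (8 * (x * B\<^sup>2)\<^sup>2) \<le> 1 * (8 * (64 * s\<^sup>2 / 10000)\<^sup>2)"
    proof -
      have "x * B\<^sup>2 \<le> s ^ 4 / 10000 * B\<^sup>2" using x_le by (intro mult_right_mono) auto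
      also have "\<dots> = 64 * s\<^sup>2 / 10000" using s by (simp add: Bs field_simps eval_nat_numeral)
      finally show ?thesis using xd_le1 x_pos d0 B s by (intro mult_mono power_mono) auto
    qed
    ultimately have "4 * x\<^sup>2 * B * d + 8 * x^3 * B^4 * d
        \<le> 32 * s ^ 3 / 10000 + 8 * (64 * s\<^sup>2 / 10000)\<^sup>2"
      by (simp add: algebra_simps eval_nat_numeral)
    also have "\<dots> \<le> s ^ 3 / 64"
    proof -
      have "s ^ 4 \<le> s ^ 3" using s by (intro power_decreasing) auto
      moreover have "8 * (64 * s\<^sup>2 / 10000)\<^sup>2 = 32768 / 100000000 * s ^ 4"
        by (simp add: power2_eq_square power4_eq_xxxx)
      moreover have "0 \<le> s ^ 3" using s by simp
      ultimately show ?thesis by linarith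
    qed
    finally show ?thesis using s by (simp add: divide_simps eval_nat_numeral algebra_simps)
  qed
  have "(1 - 2 * s) / d \<le> x * (1 - s)"
  proof -
    have "(1 - 2 * s) * (1 + s) \<le> 1 - s" by (simp add: algebra_simps)
    then show ?thesis unfolding x_def rate_def s_def[symmetric] using d0 s
      by (simp add: divide_simps mult.commute)
  qed
  also have "\<dots> \<le> x * (1 - (4 * x\<^sup>2 * B * d + 8 * x^3 * B^4 * d) / (s / 8)\<^sup>2)"
    using loss x_pos by (intro mult_left_mono) auto
  also have "\<dots> \<le> measure_pmf.expectation (unmatched x B (\<lambda>_. 1) es) (\<lambda>r. of_bool (e \<notin> set r))"
    by (rule prob_matched_ge[OF x_pos B(1) small es B(2) _ gap]) (use s in auto)
  finally show ?thesis by (simp add: s_def x_def B_def)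
qed

section \<open>All colors\<close>

lemma expectation_bind_finite:
  fixes h :: "'b \<Rightarrow> real"
  assumes "finite (set_pmf p)" "\<And>x. finite (set_pmf (f x))"
  shows "measure_pmf.expectation (bind_pmf p f) h =
    measure_pmf.expectation p (\<lambda>x. measure_pmf.expectation (f x) h)"
  using assms
  by (subst pmf_expectation_bind[of "set_pmf p"]) (auto simp: integral_measure_pmf[of "set_pmf p"])

lemma expectation_mono_finite:
  fixes g h :: "'a \<Rightarrow> real"
  assumes "finite (set_pmf p)" "\<And>x. x \<in> set_pmf p \<Longrightarrow> g x \<le> h x"
  shows "measure_pmf.expectation p g \<le> measure_pmf.expectation p h"
  using assms
  by (intro integral_mono_AE integrable_measure_pmf_finite) (auto simp: AE_measure_pmf_iff)

text \<open>The product of \<open>1 - c + c^2 / 2\<close> and \<open>1 + c + c^2 / 2\<close> is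
  \<open>1 + c^4 / 4\<close>, and the second factor is at most \<open>exp c\<close>.\<close>

lemma exp_minus_le_quadratic:
  assumes "0 \<le> (c::real)"
  shows "exp (- c) \<le> 1 - c + c\<^sup>2 / 2"
proof -
  have "1 \<le> (1 - c + c\<^sup>2 / 2) * (1 + c + c\<^sup>2 / 2)"
    using assms by (simp add: algebra_simps power2_eq_square)
  also have "\<dots> \<le> (1 - c + c\<^sup>2 / 2) * exp c"
  proof (rule mult_left_mono)
    show "1 + c + c\<^sup>2 / 2 \<le> exp c" using assms by (rule exp_lower_Taylor_quadratic)
    have eq: "1 - c + c\<^sup>2 / 2 = ((1 - c)\<^sup>2 + 1) / 2" by (simp add: power2_eq_square algebra_simps)
    show "0 \<le> 1 - c + c\<^sup>2 / 2" unfolding eq by simp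
  qed
  finally show ?thesis by (simp add: exp_minus field_simps)
qed

lemma degr_card: "distinct es \<Longrightarrow> degr v es = card {e \<in> set es. v \<in> e}"
  by (auto simp: degr_def distinct_length_filter intro!: arg_cong[where f = card])

text \<open>Writing the loss as a sum of indicators turns the bounds of \<open>layer_matches\<close>
  for single edges into a bound on its mean.\<close>

lemma degr_loss:
  assumes "r \<in> set_pmf (unmatched x B Y es)" "distinct es"
  shows "real (degr v es) - real (degr v r) = (\<Sum>e | e \<in> set es \<and> v \<in> e. of_bool (e \<notin> set r))"
proof -
  have sub: "set r \<subseteq> set es" and "distinct r"
    using unmatched_subset unmatched_distinct assms by blast+
  have "(\<Sum>e | e \<in> set es \<and> v \<in> e. of_bool (e \<notin> set r) :: real) =
      card ({e. e \<in> set es \<and> v \<in> e} \<inter> {e. e \<notin> set r})"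
    by simp
  also have "{e. e \<in> set es \<and> v \<in> e} \<inter> {e. e \<notin> set r} = {e \<in> set es. v \<in> e} - {e \<in> set r. v \<in> e}"
    by auto
  also have "real (card \<dots>) = real (card {e \<in> set es. v \<in> e}) - real (card {e \<in> set r. v \<in> e})"
    using sub by (subst card_Diff_subset) (auto intro!: of_nat_diff card_mono)
  finally show ?thesis using assms(2) \<open>distinct r\<close> by (simp add: degr_card)
qed

text \<open>The loss \<open>L\<close> is 0 or 1, so \<open>exp (c * degr v r)\<close> is an affine
  function of \<open>L\<close> and only the mean of \<open>L\<close> matters, whatever the
  dependence between the edges at \<open>v\<close>. The bound \<open>c \<le> 2\<close> keeps
  \<open>c - c^2 / 2\<close> nonnegative.\<close>

lemma expectation_exp_degr:
  fixes d c :: real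
  assumes es: "\<forall>f\<in>set es. card f = 2" "distinct es" "\<And>v. degr v es \<le> d"
    and d: "10000 \<le> d" and c: "0 \<le> c" "c \<le> 2"
  shows "measure_pmf.expectation (unmatched (rate d) (cap d) (\<lambda>_. 1) es) (\<lambda>r. exp (c * degr v r))
    \<le> exp (c * degr v es * (1 - (1 - 2 * slack d) / d * (1 - c / 2)))"
proof -
  define P where "P = unmatched (rate d) (cap d) (\<lambda>_. 1) es"
  define \<beta> where "\<beta> = (1 - 2 * slack d) / d"
  have fin: "finite (set_pmf P)" by (simp add: P_def finite_unmatched)
  note int = integrable_measure_pmf_finite[OF fin]
  define L where "L r = real (degr v es) - real (degr v r)" for r
  have L_nonneg: "0 \<le> L r" if "r \<in> set_pmf P" for r
    unfolding L_def degr_loss[OF that[unfolded P_def] es(2)] by (rule sum_nonneg) simp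
  have "exp (c * degr v r) = exp (c * degr v es) * (1 - (1 - exp (- c)) * L r)" if "r \<in> set_pmf P" for r
  proof -
    have "degr v es \<le> Suc (degr v r)" using that unmatched_loses_one by (simp add: P_def degr_def)
    moreover have "degr v r \<le> degr v es" using L_nonneg[OF that] by (simp add: L_def)
    ultimately consider "degr v r = degr v es" | "degr v es = Suc (degr v r)" by linarith
    then show ?thesis
    proof cases
      case 2
      then have "L r = 1" by (simp add: L_def)
      then show ?thesis using 2 by (simp add: exp_add[symmetric] algebra_simps)
    qed (simp add: L_def)
  qed
  then have "measure_pmf.expectation P (\<lambda>r. exp (c * degr v r)) =
      measure_pmf.expectation P (\<lambda>r. exp (c * degr v es) * (1 - (1 - exp (- c)) * L r))"
    by (intro integral_cong_AE) (auto simp: AE_measure_pmf_iff)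
  also have "\<dots> = exp (c * degr v es) * (1 - (1 - exp (- c)) * measure_pmf.expectation P L)"
    by (simp add: int)
  also have "\<dots> \<le> exp (c * degr v es) * (1 - (c - c\<^sup>2 / 2) * (degr v es * \<beta>))"
  proof -
    have "degr v es * \<beta> = (\<Sum>e | e \<in> set es \<and> v \<in> e. \<beta>)"
      using es(2) by (simp add: degr_card)
    also have "\<dots> \<le> (\<Sum>e | e \<in> set es \<and> v \<in> e. measure_pmf.expectation P (\<lambda>r. of_bool (e \<notin> set r)))"
      unfolding P_def \<beta>_def using layer_matches[OF es _ d] by (intro sum_mono) auto
    also have "\<dots> = measure_pmf.expectation P (\<lambda>r. \<Sum>e | e \<in> set es \<and> v \<in> e. of_bool (e \<notin> set r))"
      using int by (subst Bochner_Integration.integral_sum) auto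
    also have "\<dots> = measure_pmf.expectation P L"
      using degr_loss[OF _ es(2)] by (intro integral_cong_AE) (auto simp: AE_measure_pmf_iff P_def L_def)
    finally have L: "degr v es * \<beta> \<le> measure_pmf.expectation P L" .
    have L0: "0 \<le> measure_pmf.expectation P L"
      using L_nonneg by (intro integral_nonneg_AE) (auto simp: AE_measure_pmf_iff)
    have c2: "c - c\<^sup>2 / 2 \<le> 1 - exp (- c)" using exp_minus_le_quadratic[OF c(1)] by simp
    have "c - c\<^sup>2 / 2 = c * (1 - c / 2)" by (simp add: algebra_simps power2_eq_square)
    then have c3: "0 \<le> c - c\<^sup>2 / 2" using c by simp
    have "(c - c\<^sup>2 / 2) * (degr v es * \<beta>) \<le> (c - c\<^sup>2 / 2) * measure_pmf.expectation P L"
      using L c3 by (rule mult_left_mono)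
    also have "\<dots> \<le> (1 - exp (- c)) * measure_pmf.expectation P L"
      using c2 L0 by (rule mult_right_mono)
    finally show ?thesis by simp
  qed
  also have "\<dots> \<le> exp (c * degr v es) * exp (- ((c - c\<^sup>2 / 2) * (degr v es * \<beta>)))"
    using exp_ge_add_one_self[of "- ((c - c\<^sup>2 / 2) * (degr v es * \<beta>))"] by (intro mult_left_mono) auto
  also have "\<dots> = exp (c * degr v es * (1 - \<beta> * (1 - c / 2)))"
    by (simp add: exp_add[symmetric] algebra_simps power2_eq_square)
  finally show ?thesis by (simp add: P_def \<beta>_def)
qed

section \<open>Iteration over the colors\<close>

primrec layers :: "(real \<Rightarrow> real) \<Rightarrow> nat \<Rightarrow> real \<Rightarrow> real list" where
  "layers f 0 d = []"
| "layers f (Suc k) d = d # layers f k (f d)"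

lemma length_layers [simp]: "length (layers f k d) = k"
  by (induction k arbitrary: d) auto

primrec leftover :: "real list \<Rightarrow> edge list \<Rightarrow> edge list pmf" where
  "leftover [] es = return_pmf es"
| "leftover (d # ds) es = bind_pmf (unmatched (rate d) (cap d) (\<lambda>_. 1) es) (leftover ds)"

lemma finite_leftover: "finite (set_pmf (leftover ds es))"
  by (induction ds arbitrary: es) (auto simp: finite_unmatched)

text \<open>The constant is \<open>40^4\<close>. It guarantees that \<open>1 - 2 * slack d\<close>
  is at least 1/2, so every color makes progress.\<close>

lemma slack_le_quarter:
  assumes "2560000 \<le> d"
  shows "slack d \<le> 1 / 4"
proof -
  have "d powr (- 1 / 4) \<le> 2560000 powr (- 1 / 4)" using assms by (intro powr_mono2') auto
  also have "(2560000::real) powr (- 1 / 4) = (40 powr 4) powr (- 1 / 4)" by simp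
  also have "\<dots> = 1 / 40" unfolding powr_powr by (simp add: powr_minus)
  finally show "slack d \<le> 1 / 4" by (simp add: slack_def)
qed

text \<open>
  At least 1 as soon as some degree exceeds \<open>d\<close>, so that the union bound and the maximal
  inequality are both contained in \<open>leftover_tail\<close>.
\<close>

definition excess :: "nat \<Rightarrow> real \<Rightarrow> real \<Rightarrow> edge list \<Rightarrow> real" where
  "excess n \<kappa> d es = (\<Sum>v<n. exp (\<kappa> * (degr v es / d - 1)))"

lemma excess_ge_1:
  fixes d :: real
  assumes "v < n" "d < degr v es" "0 < d" "0 \<le> \<kappa>"
  shows "1 \<le> excess n \<kappa> d es"
proof -
  have "1 \<le> exp (\<kappa> * (degr v es / d - 1))" using assms by (simp add: divide_simps)
  also have "\<dots> \<le> excess n \<kappa> d es" unfolding excess_def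
    using assms by (intro member_le_sum) auto
  finally show ?thesis .
qed

text \<open>With the new bound \<open>d'\<close>, each unit of degree carries the exponent
  \<open>c = \<eta> * D / d'\<close>, which is at most \<open>\<eta>\<close>. The moment bound
  contracts the degree by a factor that, by \<open>step\<close>, takes \<open>d\<close> to at most
  \<open>d'\<close>, so \<open>degr v es / d\<close> does not increase in the exponential
  sense.\<close>

lemma excess_step:
  fixes d d' \<eta> D :: real
  assumes es: "\<forall>f\<in>set es. card f = 2" "distinct es" "\<And>v. degr v es \<le> d"
    and \<eta>: "0 < \<eta>" "\<eta> \<le> 1" and D: "2560000 \<le> D" "D \<le> d" "D \<le> d'"
    and step: "d - (1 - 2 * slack d) * (1 - \<eta> / 2) \<le> d'"
  shows "measure_pmf.expectation (unmatched (rate d) (cap d) (\<lambda>_. 1) es) (excess n (\<eta> * D) d')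
    \<le> excess n (\<eta> * D) d es"
proof -
  let ?P = "unmatched (rate d) (cap d) (\<lambda>_. 1) es"
  note int = integrable_measure_pmf_finite[OF finite_unmatched]
  define c where "c = \<eta> * D / d'"
  have pos: "0 < D" "0 < d" "0 < d'" using D by auto
  have c: "0 \<le> c" "c \<le> \<eta>" using D \<eta> pos by (auto simp: c_def divide_simps)
  have \<beta>: "0 \<le> (1 - 2 * slack d) / d" using slack_le_quarter[of d] D pos by simp
  have contract: "(1 - (1 - 2 * slack d) / d * (1 - c / 2)) / d' \<le> 1 / d"
  proof -
    have "(1 - 2 * slack d) / d * (1 - \<eta> / 2) \<le> (1 - 2 * slack d) / d * (1 - c / 2)"
      using c \<beta> by (intro mult_left_mono) auto
    then have "d * (1 - (1 - 2 * slack d) / d * (1 - c / 2)) \<le> d * (1 - (1 - 2 * slack d) / d * (1 - \<eta> / 2))"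
      using pos by (intro mult_left_mono) auto
    also have "\<dots> = d - (1 - 2 * slack d) * (1 - \<eta> / 2)" using pos by (simp add: field_simps)
    also note step
    finally show ?thesis using pos by (simp add: divide_simps mult.commute)
  qed
  have "measure_pmf.expectation ?P (\<lambda>r. exp (\<eta> * D * (degr v r / d' - 1)))
    \<le> exp (\<eta> * D * (degr v es / d - 1))" for v
  proof -
    have "exp (\<eta> * D * (degr v r / d' - 1)) = exp (- (\<eta> * D)) * exp (c * degr v r)" for r
      by (simp add: c_def exp_add[symmetric] algebra_simps)
    then have "measure_pmf.expectation ?P (\<lambda>r. exp (\<eta> * D * (degr v r / d' - 1))) =
        exp (- (\<eta> * D)) * measure_pmf.expectation ?P (\<lambda>r. exp (c * degr v r))"
      using int by simp
    also have "\<dots> \<le> exp (- (\<eta> * D)) * exp (c * degr v es * (1 - (1 - 2 * slack d) / d * (1 - c / 2)))"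
      using expectation_exp_degr[OF es, of c v] D c \<eta> by (intro mult_left_mono) auto
    also have "\<dots> \<le> exp (\<eta> * D * (degr v es / d - 1))"
    proof -
      have "c * degr v es * (1 - (1 - 2 * slack d) / d * (1 - c / 2)) =
          \<eta> * D * degr v es * ((1 - (1 - 2 * slack d) / d * (1 - c / 2)) / d')" by (simp add: c_def)
      also have "\<dots> \<le> \<eta> * D * degr v es * (1 / d)" using contract \<eta> pos by (intro mult_left_mono) auto
      finally show ?thesis by (simp add: exp_add[symmetric] algebra_simps)
    qed
    finally show ?thesis .
  qed
  then show ?thesis unfolding excess_def using int
    by (subst Bochner_Integration.integral_sum) (auto intro!: sum_mono)
qed

text \<open>Induction over the colors. If some degree already exceeds \<open>d\<close>, the excess
  is at least 1 and the bound is trivial; otherwise \<open>excess_step\<close> applies.\<close>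

lemma leftover_tail:
  fixes d \<eta> D :: real
  assumes "0 < \<eta>" "\<eta> \<le> 1" "2560000 \<le> D" "D \<le> d"
    and f: "\<And>d. D \<le> d \<Longrightarrow> D \<le> f d \<and> d - (1 - 2 * slack d) * (1 - \<eta> / 2) \<le> f d"
    and "\<forall>e\<in>set es. card e = 2 \<and> e \<subseteq> {..<n}" "distinct es"
  shows "measure_pmf.expectation (leftover (layers f k d) es)
      (\<lambda>r. of_bool (\<exists>v<n. (f ^^ k) d < degr v r)) \<le> excess n (\<eta> * D) d es"
  using assms(4,6,7)
proof (induction k arbitrary: d es)
  case 0
  have "0 \<le> excess n (\<eta> * D) d es" by (simp add: excess_def sum_nonneg)
  then show ?case using excess_ge_1[of _ n d es "\<eta> * D"] assms(1,3) 0 by (auto simp: of_bool_def)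
next
  case (Suc k)
  let ?P = "unmatched (rate d) (cap d) (\<lambda>_. 1) es"
  let ?E = "measure_pmf.expectation (leftover (layers f (Suc k) d) es)
      (\<lambda>r. of_bool (\<exists>v<n. (f ^^ Suc k) d < degr v r)) :: real"
  show ?case
  proof (cases "\<exists>v<n. d < degr v es")
    case True
    then have "1 \<le> excess n (\<eta> * D) d es"
      using excess_ge_1[of _ n d es "\<eta> * D"] assms(1,3) Suc.prems by auto
    moreover have "?E \<le> measure_pmf.expectation (leftover (layers f (Suc k) d) es) (\<lambda>_. 1)"
      by (intro expectation_mono_finite finite_leftover) auto
    ultimately show ?thesis by simp
  next
    case False
    \<comment> \<open>\<open>excess_step\<close> asks for the degree bound at every natural number;
      those outside \<open>{..<n}\<close> are in no edge.\<close>
    have deg: "degr v es \<le> d" for v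
    proof (cases "v < n")
      case False
      then have "degr v es = 0" using Suc.prems by (auto simp: degr_def filter_empty_conv)
      then show ?thesis using Suc.prems assms(3) by simp
    qed (use False in auto)
    have "?E = measure_pmf.expectation ?P (\<lambda>r. measure_pmf.expectation (leftover (layers f k (f d)) r)
        (\<lambda>r. of_bool (\<exists>v<n. (f ^^ k) (f d) < degr v r)))"
      by (simp add: expectation_bind_finite finite_unmatched finite_leftover funpow_swap1)
    also have "\<dots> \<le> measure_pmf.expectation ?P (excess n (\<eta> * D) (f d))"
    proof (intro expectation_mono_finite finite_unmatched Suc.IH)
      fix r assume "r \<in> set_pmf ?P"
      then have "set r \<subseteq> set es" "distinct r"
        using unmatched_subset unmatched_distinct Suc.prems by blast+
      then show "\<forall>e\<in>set r. card e = 2 \<and> e \<subseteq> {..<n}" "distinct r" using Suc.prems by auto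
    qed (use f Suc.prems in auto)
    also have "\<dots> \<le> excess n (\<eta> * D) d es"
      using f[OF Suc.prems(1)] Suc.prems assms(1-3) deg by (intro excess_step) auto
    finally show ?thesis .
  qed
qed

section \<open>The online algorithm\<close>

text \<open>
  The weights of color \<open>i\<close> are determined by the history, because the edges offered to
  color \<open>i\<close> are those that ended up with a color at least \<open>i\<close>.
\<close>

definition state_after :: "real \<Rightarrow> nat \<Rightarrow> history \<Rightarrow> nat \<Rightarrow> real" where
  "state_after d i h = fold (\<lambda>(e, c) Y. if c < i then Y else if c = i then hit Y e
     else miss (rate d) (cap d) Y e) h (\<lambda>_. 1)"

lemma state_after_Nil [simp]: "state_after d i [] = (\<lambda>_. 1)"
  by (simp add: state_after_def)

lemma state_after_snoc [simp]:
  "state_after d i (h @ [(e, c)]) =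
    (if c < i then state_after d i h else if c = i then hit (state_after d i h) e
     else miss (rate d) (cap d) (state_after d i h) e)"
  by (simp add: state_after_def)

text \<open>Searching upward from \<open>i\<close> separates the greedy colors from those of the
  layers, and yields a proper color even when the layers leave too many edges.\<close>

definition fresh_color :: "nat \<Rightarrow> history \<Rightarrow> edge \<Rightarrow> nat" where
  "fresh_color i h e = (LEAST c. i \<le> c \<and> (\<forall>(f, d)\<in>set h. e \<inter> f \<noteq> {} \<longrightarrow> c \<noteq> d))"

primrec layered_alg :: "real list \<Rightarrow> nat \<Rightarrow> online_alg" where
  "layered_alg [] i h e = return_pmf (fresh_color i h e)"
| "layered_alg (d # ds) i h e =
     bind_pmf (bernoulli_pmf (match_prob (rate d) (cap d) (state_after d i h) e))
       (\<lambda>b. if b then return_pmf i else layered_alg ds (Suc i) h e)"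

text \<open>
  The distribution of the edges of \<open>es\<close> that are refused by the colors
  \<open>i, i + 1, \<dots>\<close> when \<open>es\<close> arrives after the history
  \<open>h\<close>, each color processing all of \<open>es\<close> before the next one starts.
\<close>

primrec residual :: "real list \<Rightarrow> nat \<Rightarrow> history \<Rightarrow> edge list \<Rightarrow> edge list pmf" where
  "residual [] i h es = return_pmf es"
| "residual (d # ds) i h es =
     bind_pmf (unmatched (rate d) (cap d) (state_after d i h) es) (residual ds (Suc i) h)"

lemma residual_Nil_history: "residual ds i [] es = leftover ds es"
  by (induction ds arbitrary: i es) (simp_all cong: bind_pmf_cong)

lemma residual_Nil_edges: "residual ds i h [] = return_pmf []"
  by (induction ds arbitrary: i) (simp_all add: bind_return_pmf)

lemma residual_ignores: "c < i \<Longrightarrow> residual ds i (h @ [(e, c)]) es = residual ds i h es"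
  by (induction ds arbitrary: i es) (simp_all cong: bind_pmf_cong)

lemma set_bernoulli_zero: "set_pmf (bernoulli_pmf 0) = {False}"
  by (auto simp: set_pmf_iff)

lemma fresh_color:
  shows fresh_color_ge: "i \<le> fresh_color i h e"
    and fresh_color_proper: "\<forall>(f, d)\<in>set h. e \<inter> f \<noteq> {} \<longrightarrow> fresh_color i h e \<noteq> d"
    and fresh_color_le: "fresh_color i h e \<le> i + card {c. i \<le> c \<and> (\<exists>f. (f, c) \<in> set h \<and> e \<inter> f \<noteq> {})}"
proof -
  define U where "U = {c. i \<le> c \<and> (\<exists>f. (f, c) \<in> set h \<and> e \<inter> f \<noteq> {})}"
  let ?P = "\<lambda>c. i \<le> c \<and> (\<forall>(f, d)\<in>set h. e \<inter> f \<noteq> {} \<longrightarrow> c \<noteq> d)"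
  have "U \<subseteq> snd ` set h" by (force simp: U_def)
  then have fin: "finite U" by (rule finite_subset) simp
  \<comment> \<open>Pigeonhole: the interval has \<open>card U + 1\<close> elements.\<close>
  have "\<not> {i..i + card U} \<subseteq> U"
    using card_mono[OF fin, of "{i..i + card U}"] by auto
  then obtain c where "c \<in> {i..i + card U}" and c: "c \<notin> U" by blast
  then have c: "i \<le> c" "c \<le> i + card U" "c \<notin> U" by auto
  then have P: "?P c" by (auto simp: U_def)
  show "i \<le> fresh_color i h e" "\<forall>(f, d)\<in>set h. e \<inter> f \<noteq> {} \<longrightarrow> fresh_color i h e \<noteq> d"
    using LeastI[of ?P, OF P] unfolding fresh_color_def by auto
  show "fresh_color i h e \<le> i + card {c. i \<le> c \<and> (\<exists>f. (f, c) \<in> set h \<and> e \<inter> f \<noteq> {})}"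
    using Least_le[of ?P, OF P] c(2) unfolding fresh_color_def U_def by linarith
qed

lemma layered_alg_ge: "c \<in> set_pmf (layered_alg ds i h e) \<Longrightarrow> i \<le> c"
proof (induction ds arbitrary: i)
  case (Cons d ds)
  then consider "c = i" | "c \<in> set_pmf (layered_alg ds (Suc i) h e)" by (auto split: if_splits)
  then show ?case using Cons.IH[of "Suc i"] by cases auto
qed (simp add: fresh_color_ge)

lemma layered_alg_late:
  "\<lbrakk>c \<in> set_pmf (layered_alg ds i h e); i + length ds \<le> c\<rbrakk> \<Longrightarrow> c = fresh_color (i + length ds) h e"
proof (induction ds arbitrary: i)
  case (Cons d ds)
  then have "c \<in> set_pmf (layered_alg ds (Suc i) h e)" by (auto split: if_splits)
  then show ?case using Cons.IH[of "Suc i"] Cons.prems by simp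
qed simp

lemma state_after_used:
  assumes "(f, i) \<in> set h" "v \<in> f"
  shows "state_after d i h v = 0"
  using assms(1)
proof (induction h rule: rev_induct)
  case (snoc ec h)
  then show ?case using assms(2) by (cases ec) (auto simp: hit_def miss_def)
qed simp

text \<open>If an earlier edge of color \<open>i\<close> shares a vertex with \<open>e\<close>, that
  vertex has weight 0 for color \<open>i\<close>, so the coin for \<open>i\<close> always
  refuses.\<close>

lemma layered_alg_proper:
  "\<lbrakk>c \<in> set_pmf (layered_alg ds i h e); (f, c) \<in> set h\<rbrakk> \<Longrightarrow> e \<inter> f = {}"
proof (induction ds arbitrary: i)
  case Nil
  then show ?case using fresh_color_proper[of h e i] by auto
next
  case (Cons d ds)
  show ?case
  proof (cases "c = i")
    case True
    show ?thesis
    proof (rule ccontr)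
      assume "e \<inter> f \<noteq> {}"
      then obtain v where "v \<in> e" "v \<in> f" by blast
      then have "match_prob (rate d) (cap d) (state_after d i h) e = 0"
        using state_after_used[of f i h v d] Cons.prems True by (intro match_prob_zero) auto
      then have "c \<in> set_pmf (layered_alg ds (Suc i) h e)"
        using Cons.prems by (simp add: set_bernoulli_zero)
      then show False using layered_alg_ge True by fastforce
    qed
  next
    case False
    then have "c \<in> set_pmf (layered_alg ds (Suc i) h e)" using Cons.prems by (auto split: if_splits)
    then show ?thesis using Cons.IH Cons.prems by blast
  qed
qed

lemma online_layered_alg: "online_edge_coloring_alg (layered_alg ds i)"
  unfolding online_edge_coloring_alg_def
proof (intro allI ballI)
  fix h e c fd assume c: "c \<in> set_pmf (layered_alg ds i h e)" and fd: "fd \<in> set h"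
  obtain f d where "fd = (f, d)" by force
  then show "case fd of (f, d) \<Rightarrow> e \<inter> f \<noteq> {} \<longrightarrow> c \<noteq> d"
    using layered_alg_proper[OF c] fd by auto
qed

text \<open>
  Color by color and edge by edge processing agree, since the random choices of different colors
  commute.
\<close>

lemma residual_Cons:
  "residual ds i h (e # es) = bind_pmf (layered_alg ds i h e)
     (\<lambda>c. map_pmf (if i + length ds \<le> c then (#) e else id) (residual ds i (h @ [(e, c)]) es))"
proof (induction ds arbitrary: i es)
  case Nil
  show ?case using fresh_color_ge[of i h e] by (simp add: bind_return_pmf)
next
  case (Cons d ds)
  let ?Y = "state_after d i h" and ?p = "match_prob (rate d) (cap d) (state_after d i h) e"
  let ?U = "unmatched (rate d) (cap d)" and ?M = "miss (rate d) (cap d) (state_after d i h) e"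
  let ?add = "\<lambda>c. if Suc i + length ds \<le> c then (#) e else id"
  have "residual (d # ds) i h (e # es) = bind_pmf (bernoulli_pmf ?p) (\<lambda>b.
      if b then bind_pmf (?U (hit ?Y e) es) (residual ds (Suc i) h)
      else bind_pmf (?U ?M es) (\<lambda>r. residual ds (Suc i) h (e # r)))"
    by (simp add: bind_assoc_pmf map_pmf_def bind_return_pmf if_distrib[of "\<lambda>p. bind_pmf p _"] cong: bind_pmf_cong if_cong)
  also have "\<dots> = bind_pmf (bernoulli_pmf ?p) (\<lambda>b.
      if b then residual (d # ds) i (h @ [(e, i)]) es
      else bind_pmf (layered_alg ds (Suc i) h e) (\<lambda>c. map_pmf (?add c) (residual (d # ds) i (h @ [(e, c)]) es)))"
  proof (intro bind_pmf_cong refl if_cong)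
    \<comment> \<open>By the induction hypothesis, the later colors decide about \<open>e\<close>
      from \<open>h\<close> alone, so this choice can be drawn before color \<open>i\<close>
      processes \<open>es\<close>.\<close>
    have "bind_pmf (?U ?M es) (\<lambda>r. residual ds (Suc i) h (e # r)) =
      bind_pmf (layered_alg ds (Suc i) h e) (\<lambda>c. bind_pmf (?U ?M es)
        (\<lambda>r. map_pmf (?add c) (residual ds (Suc i) (h @ [(e, c)]) r)))"
      unfolding Cons.IH by (rule bind_commute_pmf)
    also have "\<dots> = bind_pmf (layered_alg ds (Suc i) h e)
        (\<lambda>c. map_pmf (?add c) (residual (d # ds) i (h @ [(e, c)]) es))"
    proof (intro bind_pmf_cong refl)
      fix c assume "c \<in> set_pmf (layered_alg ds (Suc i) h e)"
      \<comment> \<open>Because of \<open>i < c\<close>, color \<open>i\<close> sees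
        \<open>(e, c)\<close> in the history as a refusal, so its weights become the
        \<open>miss\<close> weights.\<close>
      then have "i < c" using layered_alg_ge by fastforce
      then show "bind_pmf (?U ?M es) (\<lambda>r. map_pmf (?add c) (residual ds (Suc i) (h @ [(e, c)]) r)) =
          map_pmf (?add c) (residual (d # ds) i (h @ [(e, c)]) es)"
        by (simp add: map_bind_pmf)
    qed
    finally show "bind_pmf (?U ?M es) (\<lambda>r. residual ds (Suc i) h (e # r)) = \<dots>" .
  qed (simp add: residual_ignores cong: bind_pmf_cong)
  also have "\<dots> = bind_pmf (layered_alg (d # ds) i h e)
      (\<lambda>c. map_pmf (if i + length (d # ds) \<le> c then (#) e else id) (residual (d # ds) i (h @ [(e, c)]) es))"
    by (simp add: bind_assoc_pmf bind_return_pmf if_distrib[of "\<lambda>p. bind_pmf p _"] cong: bind_pmf_cong if_cong del: residual.simps)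
  finally show ?case .
qed

section \<open>From the online run to proper colorings\<close>

definition late_edges :: "nat \<Rightarrow> history \<Rightarrow> edge list" where
  "late_edges J h = map fst (filter (\<lambda>(e, c). J \<le> c) h)"

text \<open>Repeated use of \<open>residual_Cons\<close> peels off one arrival at a time, so the
  greedily colored edges have the distribution analyzed color by color.\<close>

lemma run_from_layered:
  "map_pmf (late_edges (i + length ds)) (run_from (layered_alg ds i) h es) =
   map_pmf (\<lambda>r. late_edges (i + length ds) h @ r) (residual ds i h es)"
proof (induction es arbitrary: h)
  case Nil
  show ?case by (simp add: residual_Nil_edges)
next
  case (Cons e es)
  show ?case
    unfolding residual_Cons run_from.simps map_bind_pmf Cons.IH
    by (intro bind_pmf_cong refl) (auto simp: late_edges_def pmf.map_comp intro!: map_pmf_cong)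
qed

lemma run_from_leftover:
  "map_pmf (late_edges (length ds)) (run_from (layered_alg ds 0) [] es) = leftover ds es"
  using run_from_layered[of 0 ds "[]" es] by (simp add: residual_Nil_history late_edges_def)

text \<open>This lets statements about single choices of \<open>A\<close> be applied at every
  position of the final history.\<close>

lemma run_from_history:
  assumes "h \<in> set_pmf (run_from A h0 es)"
    and "\<And>h1 e c h2. h0 = h1 @ (e, c) # h2 \<Longrightarrow> c \<in> set_pmf (A h1 e)"
  shows "map fst h = map fst h0 @ es \<and> (\<forall>h1 e c h2. h = h1 @ (e, c) # h2 \<longrightarrow> c \<in> set_pmf (A h1 e))"
  using assms
proof (induction es arbitrary: h0)
  case Nil
  then have "h = h0" by simp
  then show ?case using Nil.prems(2) by blast
next
  case (Cons e es)
  from Cons.prems(1) obtain c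
    where c: "c \<in> set_pmf (A h0 e)" "h \<in> set_pmf (run_from A (h0 @ [(e, c)]) es)"
    by auto
  have "c' \<in> set_pmf (A h1 e')" if "h0 @ [(e, c)] = h1 @ (e', c') # h2" for h1 e' c' h2
  proof (cases h2 rule: rev_cases)
    case Nil
    then show ?thesis using that c(1) by simp
  next
    case (snoc h3 z)
    then have "h0 = h1 @ (e', c') # h3" using that by simp
    then show ?thesis by (rule Cons.prems(2))
  qed
  from Cons.IH[OF c(2) this] show ?case by simp
qed

text \<open>Colors below \<open>length ds\<close> lie in the palette by themselves. A greedy choice
  is blocked only by earlier late edges at its two endpoints. Properness is read off at the later of
  two adjacent edges.\<close>

lemma layered_output_proper:
  assumes h: "h \<in> set_pmf (run_from (layered_alg ds 0) [] es)"
    and es: "distinct es" "\<forall>e\<in>set es. card e = 2"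
    and m: "\<And>e v. e \<in> set es \<Longrightarrow> v \<in> e \<Longrightarrow> degr v (late_edges (length ds) h) \<le> m"
  shows "proper_edge_coloring (set es) {..<length ds + 2 * m} (\<lambda>e. the (map_of h e))"
proof -
  let ?J = "length ds" and ?A = "layered_alg ds 0"
  have fst_h: "map fst h = es" and step: "\<And>h1 e c h2. h = h1 @ (e, c) # h2 \<Longrightarrow> c \<in> set_pmf (?A h1 e)"
    using run_from_history[OF h] by auto
  have color: "\<exists>c. (e, c) \<in> set h \<and> the (map_of h e) = c" if "e \<in> set es" for e
  proof -
    have "e \<in> fst ` set h" using that fst_h by auto
    then obtain c where "(e, c) \<in> set h" by auto
    then show ?thesis using fst_h es(1) by auto
  qed
  show ?thesis unfolding proper_edge_coloring_def
  proof (intro conjI ballI impI)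
    fix e assume e: "e \<in> set es"
    obtain c where c: "(e, c) \<in> set h" "the (map_of h e) = c" using color[OF e] by auto
    obtain h1 h2 where split: "h = h1 @ (e, c) # h2" using c(1) by (auto simp: in_set_conv_decomp)
    have "c < ?J + 2 * m"
    proof (cases "?J \<le> c")
      case True
      obtain u v where uv: "e = {u, v}" "u \<noteq> v" using es(2) e by (auto simp: card_2_iff)
      have late: "late_edges ?J h = late_edges ?J h1 @ e # late_edges ?J h2"
        using True by (simp add: split late_edges_def)
      \<comment> \<open>\<open>e\<close> itself is late, so at most \<open>m - 1\<close> late edges
        precede it at each endpoint.\<close>
      have deg: "degr w (late_edges ?J h1) + 1 \<le> m" if "w \<in> e" for w
        using m[OF e that] that unfolding late by (simp add: degr_def)
      let ?U = "{c. ?J \<le> c \<and> (\<exists>f. (f, c) \<in> set h1 \<and> e \<inter> f \<noteq> {})}"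
      let ?near = "\<lambda>w. filter (\<lambda>(f, c). ?J \<le> c \<and> w \<in> f) h1"
      have near: "length (?near w) = degr w (late_edges ?J h1)" for w
        by (induction h1) (auto simp: late_edges_def)
      have "?U \<subseteq> snd ` set (?near u @ ?near v)" using uv by force
      then have "card ?U \<le> card (snd ` set (?near u @ ?near v))" by (intro card_mono) auto
      also have "\<dots> \<le> length (?near u @ ?near v)"
        by (rule order_trans[OF card_image_le card_length]) simp
      finally have "card ?U + 2 \<le> 2 * m" using deg[of u] deg[of v] uv by (simp add: near)
      moreover have "c = fresh_color ?J h1 e"
        using layered_alg_late[OF step[OF split]] True by simp
      then have "c \<le> ?J + card ?U" using fresh_color_le by blast
      ultimately show ?thesis by linarith
    qed simp
    then show "the (map_of h e) \<in> {..<?J + 2 * m}" using c by simp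
  next
    fix e f assume ef: "e \<in> set es" "f \<in> set es" "e \<noteq> f \<and> e \<inter> f \<noteq> {}"
    have apart: "c \<noteq> c'" if "h = h1 @ (e, c) # h2" "(f, c') \<in> set h1" "e \<inter> f \<noteq> {}" for h1 h2 e f c c'
      using layered_alg_proper[OF step[OF that(1)], of f] that by auto
    obtain c where c: "(e, c) \<in> set h" "the (map_of h e) = c" using color[OF ef(1)] by auto
    obtain c' where c': "(f, c') \<in> set h" "the (map_of h f) = c'" using color[OF ef(2)] by auto
    obtain h1 h2 where split: "h = h1 @ (e, c) # h2" using c(1) by (auto simp: in_set_conv_decomp)
    have "c \<noteq> c'"
    proof (cases "(f, c') \<in> set h1")
      case True
      with ef show ?thesis by (intro apart[OF split]) auto
    next
      case False
      then have "(f, c') \<in> set h2" using c'(1) ef(3) unfolding split by auto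
      then obtain h3 h4 where "h2 = h3 @ (f, c') # h4" by (meson split_list)
      then have "h = (h1 @ (e, c) # h3) @ (f, c') # h4" using split by simp
      then have "c' \<noteq> c" by (rule apart[where f = e]) (use ef in auto)
      then show ?thesis by simp
    qed
    then show "the (map_of h e) \<noteq> the (map_of h f)" using c c' by simp
  qed
qed

lemma layered_success_prob:
  fixes D :: real
  assumes es: "distinct es" "\<forall>e\<in>set es. card e = 2 \<and> e \<subseteq> {..<n}" and k: "length ds + 2 * nat \<lfloor>D\<rfloor> \<le> k"
  shows "1 - measure_pmf.expectation (leftover ds es) (\<lambda>r. of_bool (\<exists>v<n. D < degr v r))
    \<le> measure_pmf.prob (output_coloring (layered_alg ds 0) es)
        {\<phi>. proper_edge_coloring (set es) {..<k} \<phi>}"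
proof -
  let ?R = "run_from (layered_alg ds 0) [] es"
  let ?good = "{r. \<forall>v<n. degr v r \<le> D}"
  have "measure_pmf.expectation (leftover ds es) (\<lambda>r. of_bool (\<exists>v<n. D < degr v r)) =
      measure_pmf.prob (leftover ds es) (- ?good)"
  proof -
    have "(\<lambda>r. of_bool (\<exists>v<n. D < degr v r) :: real) = indicator (- ?good)"
      by (auto simp: fun_eq_iff not_le)
    then show ?thesis by simp
  qed
  moreover have "measure_pmf.prob (leftover ds es) (- ?good) = 1 - measure_pmf.prob (leftover ds es) ?good"
    using measure_pmf.prob_compl[of ?good "leftover ds es"] by (simp add: Compl_eq_Diff_UNIV)
  ultimately have "1 - measure_pmf.expectation (leftover ds es) (\<lambda>r. of_bool (\<exists>v<n. D < degr v r)) =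
      measure_pmf.prob (leftover ds es) ?good" by simp
  also have "\<dots> = measure_pmf.prob ?R (late_edges (length ds) -` ?good)"
    unfolding run_from_leftover[symmetric] by simp
  also have "\<dots> \<le> measure_pmf.prob ?R
      ((\<lambda>h e. the (map_of h e)) -` {\<phi>. proper_edge_coloring (set es) {..<k} \<phi>})"
  proof (rule measure_pmf.finite_measure_mono_AE)
    show "AE h in ?R. h \<in> late_edges (length ds) -` ?good \<longrightarrow>
        h \<in> (\<lambda>h e. the (map_of h e)) -` {\<phi>. proper_edge_coloring (set es) {..<k} \<phi>}"
      unfolding AE_measure_pmf_iff
    proof (intro ballI impI)
      fix h assume h: "h \<in> set_pmf ?R" "h \<in> late_edges (length ds) -` ?good"
      have "degr v (late_edges (length ds) h) \<le> nat \<lfloor>D\<rfloor>" if "e \<in> set es" "v \<in> e" for e v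
      proof -
        have "v < n" using es(2) that by blast
        then have "degr v (late_edges (length ds) h) \<le> D" using h(2) by simp
        then show ?thesis by (simp add: le_nat_floor)
      qed
      then have "proper_edge_coloring (set es) {..<length ds + 2 * nat \<lfloor>D\<rfloor>} (\<lambda>e. the (map_of h e))"
        using es by (intro layered_output_proper[OF h(1)]) auto
      then show "h \<in> (\<lambda>h e. the (map_of h e)) -` {\<phi>. proper_edge_coloring (set es) {..<k} \<phi>}"
        using k by (auto simp: proper_edge_coloring_def dest!: bspec)
    qed
  qed simp
  finally show ?thesis by (simp add: output_coloring_def)
qed

section \<open>Choice of the parameters\<close>

text \<open>The factor \<open>1 - \<eta> / 2\<close> is the price of the exponential moment. The
  \<open>max\<close> freezes the bound at \<open>D\<close>, so surplus layers do no harm.\<close>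

definition shrink :: "real \<Rightarrow> real \<Rightarrow> real \<Rightarrow> real" where
  "shrink \<eta> D d = max D (d - (1 - 2 * slack d) * (1 - \<eta> / 2))"

text \<open>
  An upper bound for the number of colors needed to shrink the degree bound from \<open>d\<close>.
\<close>

definition budget :: "real \<Rightarrow> real \<Rightarrow> real" where
  "budget \<eta> d = (1 + \<eta>) * d + 120 * d powr (3 / 4)"

text \<open>The tangent inequality for a concave power. In terms of fourth roots it is the
  nonnegativity of \<open>z^4 - 4*z*w^3 + 3*w^4\<close>, which has the factor
  \<open>(z - w)^2\<close>.\<close>

lemma powr_three_quarters_decrease:
  assumes "0 < d" "0 \<le> s" "s \<le> (d::real)"
  shows "3 / 4 * s * d powr (- 1 / 4) \<le> d powr (3 / 4) - (d - s) powr (3 / 4)"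
proof -
  define z where "z = d powr (1 / 4)"
  define w where "w = (d - s) powr (1 / 4)"
  have z: "0 < z" using assms by (simp add: z_def)
  have w: "0 \<le> w" by (simp add: w_def)
  have zw: "w \<le> z" using assms by (auto simp: z_def w_def intro!: powr_mono2)
  have pow: "(a powr (1 / 4)) ^ k = a powr (k / 4)" if "0 < k" "0 \<le> a" for a :: real and k
    using that by (cases "a = 0") (simp_all add: powr_realpow[symmetric] powr_powr)
  have z3: "z ^ 3 = d powr (3 / 4)" and w3: "w ^ 3 = (d - s) powr (3 / 4)"
    and z4: "z ^ 4 = d" and w4: "w ^ 4 = d - s"
    using pow[of 3] pow[of 4] assms by (auto simp: z_def w_def)
  have inv: "d powr (- 1 / 4) = 1 / z" by (simp add: z_def powr_minus_divide)
  have "3 * s \<le> 4 * (z * (z ^ 3 - w ^ 3))"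
  proof -
    have "z ^ 4 - 4 * z * w ^ 3 + 3 * w ^ 4 = (z - w)\<^sup>2 * (z\<^sup>2 + 2 * z * w + 3 * w\<^sup>2)"
      by (simp add: algebra_simps eval_nat_numeral)
    also have "\<dots> \<ge> 0" using z w by (intro mult_nonneg_nonneg add_nonneg_nonneg) auto
    finally have "0 \<le> z ^ 4 - 4 * z * w ^ 3 + 3 * w ^ 4" .
    moreover have "z * z ^ 3 = z ^ 4" by (simp add: eval_nat_numeral)
    moreover have "s = z ^ 4 - w ^ 4" using z4 w4 by simp
    ultimately show ?thesis by (simp add: algebra_simps)
  qed
  then show ?thesis unfolding inv z3[symmetric] w3[symmetric] using z by (simp add: field_simps)
qed

text \<open>The factor \<open>1 + \<eta>\<close> makes up for \<open>1 - \<eta> / 2\<close>. The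
  power term drops by at least \<open>90 * s * y\<close>, where \<open>90 = 120 * 3 / 4\<close>, and
  this makes up for \<open>1 - 20 * y\<close>.\<close>

lemma budget_decrease:
  assumes "0 < \<eta>" "\<eta> \<le> 1" "2560000 \<le> d"
  shows "budget \<eta> (d - (1 - 2 * slack d) * (1 - \<eta> / 2)) + 1 \<le> budget \<eta> d"
proof -
  define y where "y = d powr (- 1 / 4)"
  define s where "s = (1 - 2 * slack d) * (1 - \<eta> / 2)"
  have slack: "slack d = 10 * y" by (simp add: slack_def y_def)
  have y: "0 \<le> y" "y \<le> 1 / 40" using slack_le_quarter[OF assms(3)] by (simp_all add: y_def slack_def)
  have s0: "0 \<le> s" using assms y by (simp add: s_def slack)
  have "(1 - 20 * y) * (1 - \<eta> / 2) \<le> 1 * 1" using assms y by (intro mult_mono) auto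
  then have "s \<le> d" using assms by (simp add: s_def slack)
  then have "3 / 4 * s * y \<le> d powr (3 / 4) - (d - s) powr (3 / 4)"
    unfolding y_def using assms s0 by (intro powr_three_quarters_decrease) auto
  then have drop: "(1 + \<eta>) * s + 90 * s * y \<le> budget \<eta> d - budget \<eta> (d - s)"
    by (simp add: budget_def algebra_simps)
  have 1: "1 \<le> (1 - \<eta> / 2) * (1 + \<eta>)"
    using assms mult_left_le[of \<eta> \<eta>] by (simp add: algebra_simps)
  have 2: "1 \<le> (1 - 20 * y) * (1 + 40 * y)"
    using y mult_left_mono[OF y(2) y(1)] by (simp add: algebra_simps)
  have "1 * 1 \<le> ((1 - \<eta> / 2) * (1 + \<eta>)) * ((1 - 20 * y) * (1 + 40 * y))"
    using 1 2 by (intro mult_mono) auto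
  also have "\<dots> = s * ((1 + \<eta>) * (1 + 40 * y))" by (simp add: s_def slack)
  also have "\<dots> \<le> s * (1 + \<eta> + 90 * y)"
    using s0 assms y mult_right_mono[of \<eta> 1 y] by (intro mult_left_mono) (auto simp: algebra_simps)
  also have "\<dots> = (1 + \<eta>) * s + 90 * s * y" by (simp add: algebra_simps)
  finally show ?thesis using drop by (simp add: s_def)
qed

text \<open>Until \<open>D\<close> is reached, every step uses up at least 1 of the budget, which
  stays positive.\<close>

lemma shrink_reaches:
  assumes \<eta>: "0 < \<eta>" "\<eta> \<le> 1" and D: "2560000 \<le> D" "D \<le> d" and k: "budget \<eta> d \<le> real k"
  shows "(shrink \<eta> D ^^ k) d = D"
proof -
  have "D \<le> (shrink \<eta> D ^^ j) d \<and>
      ((shrink \<eta> D ^^ j) d = D \<or> budget \<eta> ((shrink \<eta> D ^^ j) d) + j \<le> budget \<eta> d)" for j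
  proof (induction j)
    case (Suc j)
    define b where "b = (shrink \<eta> D ^^ j) d"
    have b: "D \<le> b" using Suc by (simp add: b_def)
    have step: "(shrink \<eta> D ^^ Suc j) d = shrink \<eta> D b" by (simp add: b_def)
    show ?case
    proof (cases "shrink \<eta> D b = D")
      case False
      then have eq: "shrink \<eta> D b = b - (1 - 2 * slack b) * (1 - \<eta> / 2)"
        by (auto simp: shrink_def max_def split: if_splits)
      have "b \<noteq> D"
      proof
        assume "b = D"
        then have "0 \<le> (1 - 2 * slack b) * (1 - \<eta> / 2)"
          using slack_le_quarter[of b] D \<eta> by simp
        then show False using False \<open>b = D\<close> by (simp add: shrink_def max_def split: if_splits)
      qed
      then have "budget \<eta> b + j \<le> budget \<eta> d" using Suc by (simp add: b_def)
      moreover have "budget \<eta> (shrink \<eta> D b) + 1 \<le> budget \<eta> b"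
        unfolding eq using b D \<eta> by (intro budget_decrease) auto
      ultimately show ?thesis unfolding step by (auto simp: shrink_def)
    qed (use step in auto)
  qed (use D in simp)
  from this[of k] have b: "D \<le> (shrink \<eta> D ^^ k) d"
    "(shrink \<eta> D ^^ k) d = D \<or> budget \<eta> ((shrink \<eta> D ^^ k) d) \<le> 0"
    using k by auto
  have "0 < budget \<eta> ((shrink \<eta> D ^^ k) d)"
    unfolding budget_def using b(1) D \<eta> by (intro add_pos_nonneg) auto
  with b show ?thesis by auto
qed

text \<open>
  Chosen such that \<open>ratio n d ^ 3 * d = 4 * ln n\<close>, which makes the initial excess at most
  \<open>1 / n\<close>.
\<close>

definition ratio :: "nat \<Rightarrow> nat \<Rightarrow> real" where
  "ratio n d = (4 * ln n / d) powr (1 / 3)"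

text \<open>Starting from \<open>(1 + ratio n d) * d\<close> instead of \<open>d\<close> gives the
  head start that makes the initial excess small.\<close>

definition num_layers :: "nat \<Rightarrow> nat \<Rightarrow> nat" where
  "num_layers n d = nat \<lceil>budget (ratio n d) ((1 + ratio n d) * d)\<rceil>"

definition coloring_alg :: "nat \<Rightarrow> nat \<Rightarrow> online_alg" where
  "coloring_alg n d = layered_alg
     (layers (shrink (ratio n d) (ratio n d * d)) (num_layers n d) ((1 + ratio n d) * d)) 0"

text \<open>With truncated subtraction, \<open>d + extra_colors n d\<close> is at least the size of
  the palette in every case.\<close>

definition extra_colors :: "nat \<Rightarrow> nat \<Rightarrow> nat" where
  "extra_colors n d = num_layers n d + 2 * nat \<lfloor>ratio n d * d\<rfloor> - d"

lemma degr_le_max_degree: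
  assumes "edge_arrivals n d es" "v < n"
  shows "degr v es \<le> d"
proof -
  have "card {e \<in> set es. v \<in> e} \<le> max_degree n (set es)"
    unfolding max_degree_def using assms(2) by (intro Max_ge) auto
  then show ?thesis using assms(1) by (auto simp: edge_arrivals_def degr_card)
qed

text \<open>The head start makes every ratio at most \<open>1 - \<eta> / 2\<close>, so each exponent
  is at most \<open>- \<eta>^3 * d / 2 = - 2 * ln n\<close>, and each of the \<open>n\<close>
  summands at most \<open>1 / n^2\<close>.\<close>

lemma excess_initial:
  fixes \<eta> :: real
  assumes es: "edge_arrivals n d es" and "0 < \<eta>" "\<eta> \<le> 1" "0 < d" "0 < n" "\<eta> ^ 3 * d = 4 * ln n"
  shows "excess n (\<eta> * (\<eta> * d)) ((1 + \<eta>) * d) es \<le> 1 / n"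
proof -
  have "exp (\<eta> * (\<eta> * d) * (degr v es / ((1 + \<eta>) * d) - 1)) \<le> 1 / real n ^ 2" if "v < n" for v
  proof -
    have "degr v es / ((1 + \<eta>) * d) \<le> d / ((1 + \<eta>) * d)"
      using degr_le_max_degree[OF es that] assms by (intro divide_right_mono) auto
    also have "\<dots> = 1 / (1 + \<eta>)" using assms by simp
    also have "\<dots> \<le> 1 - \<eta> / 2"
      using assms mult_left_le[of \<eta> \<eta>] by (simp add: divide_simps) (simp add: algebra_simps)
    finally have "\<eta> * (\<eta> * d) * (degr v es / ((1 + \<eta>) * d) - 1) \<le> \<eta> * (\<eta> * d) * (- (\<eta> / 2))"
      using assms by (intro mult_left_mono) auto
    also have "\<dots> = - (\<eta> ^ 3 * d) / 2" by (simp add: eval_nat_numeral)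
    also have "\<dots> = - (2 * ln n)" using assms by simp
    finally have "exp (\<eta> * (\<eta> * d) * (degr v es / ((1 + \<eta>) * d) - 1)) \<le> exp (- (2 * ln n))" by simp
    also have "\<dots> = 1 / real n ^ 2"
      using assms by (simp add: exp_minus field_simps exp_double)
    finally show ?thesis .
  qed
  then have "excess n (\<eta> * (\<eta> * d)) ((1 + \<eta>) * d) es \<le> (\<Sum>v<n. 1 / real n ^ 2)"
    unfolding excess_def by (intro sum_mono) auto
  also have "\<dots> = 1 / n" using assms by (simp add: power2_eq_square)
  finally show ?thesis .
qed

lemma coloring_alg_success:
  assumes es: "edge_arrivals n d es" and "1 < n" "0 < d"
    and "ratio n d \<le> 1" "2560000 \<le> ratio n d * d"
  shows "1 - 1 / n \<le> measure_pmf.prob (output_coloring (coloring_alg n d) es)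
    {\<phi>. proper_edge_coloring (set es) {..<d + extra_colors n d} \<phi>}"
proof -
  let ?\<eta> = "ratio n d"
  let ?D = "?\<eta> * d" and ?J = "num_layers n d" and ?d = "(1 + ?\<eta>) * d"
  let ?f = "shrink ?\<eta> ?D"
  have \<eta>: "0 < ?\<eta>" using assms by (simp add: ratio_def)
  have cube: "?\<eta> ^ 3 * d = 4 * ln n"
    using assms \<eta> by (simp add: ratio_def powr_realpow[symmetric] powr_powr)
  have es': "distinct es" "\<forall>e\<in>set es. card e = 2 \<and> e \<subseteq> {..<n}"
    using es by (auto simp: edge_arrivals_def)
  have D: "?D \<le> ?d" using assms by (simp add: algebra_simps)
  have "budget ?\<eta> ?d \<le> ?J" by (simp add: num_layers_def real_nat_ceiling_ge)
  then have reach: "(?f ^^ ?J) ?d = ?D" using \<eta> assms D by (intro shrink_reaches) auto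
  have "measure_pmf.expectation (leftover (layers ?f ?J ?d) es) (\<lambda>r. of_bool (\<exists>v<n. ?D < degr v r))
      \<le> excess n (?\<eta> * ?D) ?d es"
    using leftover_tail[of ?\<eta> ?D ?d ?f es n ?J] \<eta> assms D es' unfolding reach
    by (simp add: shrink_def)
  also have "\<dots> \<le> 1 / n" using assms \<eta> cube by (intro excess_initial) auto
  finally have "1 - 1 / n \<le> 1 - measure_pmf.expectation (leftover (layers ?f ?J ?d) es)
      (\<lambda>r. of_bool (\<exists>v<n. ?D < degr v r))" by simp
  also have "\<dots> \<le> measure_pmf.prob (output_coloring (coloring_alg n d) es)
      {\<phi>. proper_edge_coloring (set es) {..<d + extra_colors n d} \<phi>}"
    unfolding coloring_alg_def
    by (rule layered_success_prob[OF es']) (simp add: extra_colors_def)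
  finally show ?thesis .
qed

lemma extra_colors_le:
  assumes "1 < n" "1 \<le> d" "ratio n d \<le> 1"
  shows "extra_colors n d \<le> 5 * (ratio n d * d) + 241 * d powr (3 / 4)"
proof -
  let ?\<eta> = "ratio n d"
  have \<eta>: "0 \<le> ?\<eta>" by (simp add: ratio_def)
  have "(1 + ?\<eta>) powr (3 / 4) \<le> 2 powr 1"
    using \<eta> assms by (intro powr_mono_both) auto
  then have p: "((1 + ?\<eta>) * d) powr (3 / 4) \<le> 2 * d powr (3 / 4)"
    using \<eta> by (simp add: powr_mult mult_right_mono)
  have d: "1 \<le> d powr (3 / 4)" using assms by (intro ge_one_powr_ge_zero) auto
  have sq: "?\<eta> * ?\<eta> * d \<le> 1 * ?\<eta> * d" using \<eta> assms by (intro mult_right_mono) auto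
  have "0 \<le> budget ?\<eta> ((1 + ?\<eta>) * d)" using \<eta> by (simp add: budget_def)
  then have "num_layers n d \<le> budget ?\<eta> ((1 + ?\<eta>) * d) + 1" by (simp add: num_layers_def)
  \<comment> \<open>\<open>(1 + \<eta>)^2 \<le> 1 + 3 * \<eta>\<close> for
    \<open>\<eta> \<le> 1\<close>, and the power term at most doubles.\<close>
  also have "\<dots> \<le> d + 3 * (?\<eta> * d) + 240 * d powr (3 / 4) + 1"
    using p sq by (simp add: budget_def algebra_simps)
  finally have J: "num_layers n d \<le> d + 3 * (?\<eta> * d) + 240 * d powr (3 / 4) + 1" .
  have "real (nat \<lfloor>?\<eta> * d\<rfloor>) \<le> ?\<eta> * d" using \<eta> by simp
  then have "real (num_layers n d + 2 * nat \<lfloor>?\<eta> * d\<rfloor>) - d \<le> 5 * (?\<eta> * d) + 241 * d powr (3 / 4)"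
    using J d by simp
  moreover have "0 \<le> 5 * (?\<eta> * d) + 241 * d powr (3 / 4)" using \<eta> by simp
  ultimately show ?thesis unfolding extra_colors_def
    by (cases "d \<le> num_layers n d + 2 * nat \<lfloor>?\<eta> * d\<rfloor>") auto
qed

section \<open>Asymptotics for degrees growing faster than the logarithm\<close>

context
  fixes \<Delta> :: "nat \<Rightarrow> nat"
  assumes \<Delta>: "(\<lambda>n. real (\<Delta> n)) \<in> \<omega>(\<lambda>n. ln (real n))"
begin

lemma ln_at_top_nat: "filterlim (\<lambda>n. ln (real n)) at_top sequentially"
  by (rule filterlim_compose[OF ln_at_top filterlim_real_sequentially])

lemma eventually_ln_ge: "\<forall>\<^sub>F n in sequentially. K \<le> ln (real n)"
  using ln_at_top_nat by (simp add: filterlim_at_top)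

lemma eventually_degree_ge: "\<forall>\<^sub>F n in sequentially. ln (real n) \<le> \<Delta> n"
  using landau_omega.smallD[OF \<Delta> zero_less_one] eventually_ln_ge[of 0]
  by eventually_elim auto

lemma degree_at_top: "filterlim (\<lambda>n. real (\<Delta> n)) at_top sequentially"
  by (rule filterlim_at_top_mono[OF ln_at_top_nat]) (rule eventually_degree_ge)

lemma ratio_tendsto_0: "(\<lambda>n. ratio n (\<Delta> n)) \<longlonglongrightarrow> 0"
proof -
  have "(\<lambda>n. ln (real n) / \<Delta> n) \<longlonglongrightarrow> 0"
    using \<Delta> by (intro smalloD_tendsto) (simp add: smallomega_iff_smallo)
  then have "(\<lambda>n. 4 * (ln (real n) / \<Delta> n)) \<longlonglongrightarrow> 4 * 0" by (intro tendsto_intros)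
  then have "(\<lambda>n. 4 * ln (real n) / \<Delta> n) \<longlonglongrightarrow> 0" by simp
  then show ?thesis unfolding ratio_def
    by (rule tendsto_zero_powrI) (use eventually_ln_ge[of 0] in \<open>auto elim: eventually_mono\<close>)
qed

lemma eventually_ratio_le_1: "\<forall>\<^sub>F n in sequentially. ratio n (\<Delta> n) \<le> 1"
  using order_tendstoD(2)[OF ratio_tendsto_0, of 1] by (auto elim: eventually_mono)

text \<open>Up to a constant, the bound at which greedy coloring takes over is the second error term
  of the theorem.\<close>

lemma eventually_ratio_degree:
  "\<forall>\<^sub>F n in sequentially. ratio n (\<Delta> n) * \<Delta> n = 4 powr (1 / 3) * (ln n powr (1 / 3) * \<Delta> n powr (2 / 3))"
  using eventually_ln_ge[of 1] eventually_degree_ge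
proof eventually_elim
  case (elim n)
  then have "ratio n (\<Delta> n) * \<Delta> n =
      4 powr (1 / 3) * (ln n powr (1 / 3) * (\<Delta> n powr 1 / \<Delta> n powr (1 / 3)))"
    by (simp add: ratio_def powr_divide powr_mult)
  also have "\<Delta> n powr 1 / \<Delta> n powr (1 / 3) = \<Delta> n powr (2 / 3)"
    by (subst powr_diff[symmetric]) simp
  finally show ?case .
qed

lemma eventually_stop_large: "\<forall>\<^sub>F n in sequentially. K \<le> ratio n (\<Delta> n) * \<Delta> n"
proof -
  have "filterlim (\<lambda>n. real (\<Delta> n) powr (2 / 3)) at_top sequentially"
    by (rule filterlim_compose[OF _ degree_at_top]) real_asymp
  then have "\<forall>\<^sub>F n in sequentially. K \<le> \<Delta> n powr (2 / 3)" by (simp add: filterlim_at_top)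
  with eventually_ratio_degree eventually_ln_ge[of 1] show ?thesis
  proof eventually_elim
    case (elim n)
    have "1 * (1 * \<Delta> n powr (2 / 3)) \<le> 4 powr (1 / 3) * (ln n powr (1 / 3) * \<Delta> n powr (2 / 3))"
      using elim by (intro mult_mono ge_one_powr_ge_zero) auto
    with elim show ?case by simp
  qed
qed

lemma coloring_alg_whp:
  "\<forall>\<^sub>F n in sequentially. \<forall>es. edge_arrivals n (\<Delta> n) es \<longrightarrow>
     measure_pmf.prob (output_coloring (coloring_alg n (\<Delta> n)) es)
       {\<phi>. proper_edge_coloring (set es) {..<\<Delta> n + extra_colors n (\<Delta> n)} \<phi>} \<ge> 1 - real n powr (- 1)"
  using eventually_ln_ge[of 1] eventually_degree_ge eventually_ratio_le_1
    eventually_stop_large[of 2560000] eventually_gt_at_top[of 1]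
proof eventually_elim
  case (elim n)
  then show ?case using coloring_alg_success[of n "\<Delta> n"] by (auto simp: powr_minus_divide)
qed

lemma eventually_extra_colors_le:
  "\<forall>\<^sub>F n in sequentially. extra_colors n (\<Delta> n) \<le> 5 * (ratio n (\<Delta> n) * \<Delta> n) + 241 * \<Delta> n powr (3 / 4)"
  using eventually_ratio_le_1 eventually_gt_at_top[of 1] eventually_ln_ge[of 1] eventually_degree_ge
proof eventually_elim
  case (elim n)
  then show ?case by (intro extra_colors_le) auto
qed

text \<open>Once \<open>\<Delta> n\<close> is at least \<open>exp 1\<close>, the factor
  \<open>ln (\<Delta> n) powr (1/2)\<close> is at least 1, so \<open>extra_colors_le\<close>
  suffices.\<close>

lemma extra_colors_bigo:
  "(\<lambda>n. real (extra_colors n (\<Delta> n))) \<in>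
     O(\<lambda>n. real (\<Delta> n) powr (3/4) * ln (real (\<Delta> n)) powr (1/2)
          + real (\<Delta> n) powr (2/3) * ln (real n) powr (1/3))"
proof (rule bigoI[where c = 241])
  have "\<forall>\<^sub>F n in sequentially. exp 1 \<le> real (\<Delta> n)"
    using degree_at_top by (simp add: filterlim_at_top)
  with eventually_extra_colors_le eventually_ratio_degree
  show "\<forall>\<^sub>F n in sequentially. norm (real (extra_colors n (\<Delta> n))) \<le>
      241 * norm (real (\<Delta> n) powr (3/4) * ln (real (\<Delta> n)) powr (1/2)
          + real (\<Delta> n) powr (2/3) * ln (real n) powr (1/3))"
  proof eventually_elim
    case (elim n)
    have "(4::real) powr (1 / 3) \<le> 4 powr 1" by (intro powr_mono) auto
    then have *: "4 powr (1 / 3) * (ln n powr (1 / 3) * \<Delta> n powr (2 / 3))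
        \<le> 4 * (ln n powr (1 / 3) * \<Delta> n powr (2 / 3))"
      by (intro mult_right_mono) auto
    define a where "a = \<Delta> n powr (2 / 3) * ln n powr (1 / 3)"
    define b where "b = \<Delta> n powr (3 / 4) * ln (real (\<Delta> n)) powr (1 / 2)"
    have "5 * (ratio n (\<Delta> n) * \<Delta> n) \<le> 20 * a"
      using * unfolding elim(2) a_def by (simp add: mult_ac)
    moreover have "0 < real (\<Delta> n)" using elim(3) exp_gt_zero[of "1::real"] by linarith
    then have "1 \<le> ln (real (\<Delta> n))" using elim(3) by (simp add: ln_ge_iff)
    then have "\<Delta> n powr (3 / 4) * 1 \<le> b" unfolding b_def
      by (intro mult_left_mono ge_one_powr_ge_zero) auto
    moreover have "0 \<le> a" "0 \<le> b" by (simp_all add: a_def b_def)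
    moreover have "t \<le> 241 * (b + a)" if "t \<le> r + 241 * p" "r \<le> 20 * a" "p * 1 \<le> b" "0 \<le> a"
      for t r p :: real using that by simp
    ultimately have "extra_colors n (\<Delta> n) \<le> 241 * (b + a)" using elim(1) by blast
    then show ?case using \<open>0 \<le> a\<close> \<open>0 \<le> b\<close> unfolding a_def b_def by simp
  qed
qed

text \<open>Relative to \<open>\<Delta> n\<close>, the extra colors are at most
  \<open>5 * ratio n (\<Delta> n) + 241 * \<Delta> n powr (- 1 / 4)\<close>, and both terms
  vanish.\<close>

lemma total_colors_equiv:
  "(\<lambda>n. real (\<Delta> n + extra_colors n (\<Delta> n))) \<sim>[at_top] (\<lambda>n. real (\<Delta> n))"
proof (rule asymp_equivI')
  have pos: "\<forall>\<^sub>F n in sequentially. 0 < real (\<Delta> n)"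
    using eventually_ln_ge[of 1] eventually_degree_ge by eventually_elim linarith
  have "(\<lambda>n. extra_colors n (\<Delta> n) / \<Delta> n) \<longlonglongrightarrow> 0"
  proof (rule tendsto_sandwich[where f = "\<lambda>_. 0"])
    have "((\<lambda>d::real. 241 * d powr (- 1 / 4)) \<longlongrightarrow> 0) at_top" by real_asymp
    from filterlim_compose[OF this degree_at_top]
    have "(\<lambda>n. 5 * ratio n (\<Delta> n) + 241 * \<Delta> n powr (- 1 / 4)) \<longlonglongrightarrow> 5 * 0 + 0"
      by (intro tendsto_intros ratio_tendsto_0) auto
    then show "(\<lambda>n. 5 * ratio n (\<Delta> n) + 241 * \<Delta> n powr (- 1 / 4)) \<longlonglongrightarrow> 0" by simp
    show "\<forall>\<^sub>F n in sequentially. extra_colors n (\<Delta> n) / \<Delta> n \<le> 5 * ratio n (\<Delta> n) + 241 * \<Delta> n powr (- 1 / 4)"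
      using eventually_extra_colors_le pos
    proof eventually_elim
      case (elim n)
      have "\<Delta> n powr (3 / 4) / \<Delta> n powr 1 = \<Delta> n powr (- 1 / 4)" by (subst powr_diff[symmetric]) simp
      then have "\<Delta> n powr (3 / 4) = \<Delta> n powr (- 1 / 4) * \<Delta> n" using elim by (simp add: field_simps)
      then show ?case using elim by (simp add: divide_simps algebra_simps)
    qed
  qed (auto intro: always_eventually)
  then have "(\<lambda>n. 1 + extra_colors n (\<Delta> n) / \<Delta> n) \<longlonglongrightarrow> 1 + 0" by (intro tendsto_intros)
  moreover have "\<forall>\<^sub>F n in sequentially. 1 + extra_colors n (\<Delta> n) / \<Delta> n =
      real (\<Delta> n + extra_colors n (\<Delta> n)) / real (\<Delta> n)"
    using pos by eventually_elim (simp add: field_simps)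
  ultimately show "(\<lambda>n. real (\<Delta> n + extra_colors n (\<Delta> n)) / real (\<Delta> n)) \<longlonglongrightarrow> 1"
    using Lim_transform_eventually by fastforce
qed

end

theorem theorem4p11:
  shows "\<exists>(A :: nat \<Rightarrow> nat \<Rightarrow> online_alg) (q :: nat \<Rightarrow> nat \<Rightarrow> nat) (c :: real).
    (\<forall>n d. online_edge_coloring_alg (A n d)) \<and> c > 0 \<and>
    (\<forall>\<Delta> :: nat \<Rightarrow> nat. (\<lambda>n. real (\<Delta> n)) \<in> \<omega>(\<lambda>n. ln (real n)) \<longrightarrow>
      (\<forall>\<^sub>F n in sequentially. \<forall>es. edge_arrivals n (\<Delta> n) es \<longrightarrow>
        measure_pmf.prob (output_coloring (A n (\<Delta> n)) es)
          {\<phi>. proper_edge_coloring (set es) {..<\<Delta> n + q n (\<Delta> n)} \<phi>}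
        \<ge> 1 - real n powr (-c)) \<and>
      (\<lambda>n. real (q n (\<Delta> n))) \<in>
        O(\<lambda>n. real (\<Delta> n) powr (3/4) * ln (real (\<Delta> n)) powr (1/2)
             + real (\<Delta> n) powr (2/3) * ln (real n) powr (1/3)) \<and>
      (\<lambda>n. real (\<Delta> n + q n (\<Delta> n))) \<sim>[at_top] (\<lambda>n. real (\<Delta> n)))"
proof (rule exI[of _ coloring_alg], rule exI[of _ extra_colors], rule exI[of _ 1], intro conjI allI impI)
  show "online_edge_coloring_alg (coloring_alg n d)" for n d
    unfolding coloring_alg_def by (rule online_layered_alg)
next
  fix \<Delta> :: "nat \<Rightarrow> nat" assume "(\<lambda>n. real (\<Delta> n)) \<in> \<omega>(\<lambda>n. ln (real n))"
  note thms = coloring_alg_whp[OF this] extra_colors_bigo[OF this] total_colors_equiv[OF this]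
  show "\<forall>\<^sub>F n in sequentially. \<forall>es. edge_arrivals n (\<Delta> n) es \<longrightarrow>
     measure_pmf.prob (output_coloring (coloring_alg n (\<Delta> n)) es)
       {\<phi>. proper_edge_coloring (set es) {..<\<Delta> n + extra_colors n (\<Delta> n)} \<phi>} \<ge> 1 - real n powr (- 1)"
    by (rule thms)
  show "(\<lambda>n. real (extra_colors n (\<Delta> n))) \<in>
     O(\<lambda>n. real (\<Delta> n) powr (3/4) * ln (real (\<Delta> n)) powr (1/2)
          + real (\<Delta> n) powr (2/3) * ln (real n) powr (1/3))"
    by (rule thms)
  show "(\<lambda>n. real (\<Delta> n + extra_colors n (\<Delta> n))) \<sim>[at_top] (\<lambda>n. real (\<Delta> n))"
    by (rule thms)
qed simp

end
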